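(* Let $k>2$ be an even integer, let $c>0$ be fixed, and for a positive integer $n$ and $\kappa>0$ let \[S_0(n,\kappa)=\sum_{\substack{l,f\geq1,\ \xi\in\mathbb{Z}\\ lf^2\xi\geq c\,n^{\frac12+\kappa}}}\tfrac{Kl_{l,f}(\xi,n)}{\sqrt l}\,\tfrac{I_{l,f}(\xi,n)}{(lf^2)^{3/2}}.\] Then for every $N>0$ and $\kappa>0$, $S_0(n,\kappa)\ll n^{\frac12-N\kappa}$ for all $n\geq1$, where the implied constant depends only on $k,N,\kappa$ (and $c$).
   Context: Write $e(x)=e^{2\pi i x}$. $\theta_\infty:\mathbb{R}\to\mathbb{R}$ is $\theta_\infty(x)=\tfrac{i}{2\pi}\{(x+\sqrt{x^2-1})^{k-1}-(x-\sqrt{x^2-1})^{k-1}\}$ for $|x|<1$, with $\sqrt{x^2-1}=i\sqrt{1-x^2}$, and $\theta_\infty(x)=0$ for $|x|\geq1$. $F(x)=\tfrac{1}{2K_0(2)}\int_x^\infty e^{-y-1/y}\tfrac{dy}{y}$ for $x>0$ ($K_0$ the modified Bessel function), $\tilde F$ its Mellin transform (meromorphically continued, only pole simple at $0$ with residue $1$), and for $y>0$, $H(y)=\tfrac{\sqrt\pi}{2\pi i}\int_{\Re(u)=1}\tfrac{\Gamma(\frac{1+u}{2})}{\Gamma(\frac{2-u}{2})}(\pi y)^{-u}\tilde F(u)\,du$. For positive integers $l,f,n$ and $\xi\in\mathbb{Z}$, with $t=\tfrac{lf^2(4n)^{-1/2}}{\sqrt{1-x^2}}$, \[I_{l,f}(\xi,n)=\int_{-1}^{1}\theta_\infty(x)\bigl\{F(t)+t\,H(t)\bigr\}e\Bigl(\tfrac{-x\xi\sqrt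 n}{2lf^2}\Bigr)dx,\quad Kl_{l,f}(\xi,n)=\sum_{\substack{a\bmod 4lf^2\\ a^2\equiv 4n\bmod f^2\\ (a^2-4n)/f^2\equiv 0,1\bmod 4}}\Bigl(\tfrac{(a^2-4n)/f^2}{l}\Bigr)e\Bigl(\tfrac{a\xi}{4lf^2}\Bigr),\] with $(\tfrac{\cdot}{l})$ the Kronecker symbol. *)

theory Defs
  imports "HOL-Analysis.Analysis" "HOL-Number_Theory.Number_Theory"
begin

definition e_add :: "real \<Rightarrow> complex" where
  "e_add x = exp (2 * complex_of_real pi * \<i> * complex_of_real x)"

text \<open>The formula is written with complex numbers; its values are real, see
  \<open>theta_inf_real\<close> below.\<close>

definition theta_inf :: "nat \<Rightarrow> real \<Rightarrow> complex" where
  "theta_inf k x =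
     (if \<bar>x\<bar> < 1 then
        \<i> / (2 * complex_of_real pi) *
          ((complex_of_real x + \<i> * complex_of_real (sqrt (1 - x\<^sup>2))) ^ (k - 1)
           - (complex_of_real x - \<i> * complex_of_real (sqrt (1 - x\<^sup>2))) ^ (k - 1))
      else 0)"

lemma theta_inf_real: "theta_inf k x \<in> \<real>"
proof -
  define z where "z = complex_of_real x + \<i> * complex_of_real (sqrt (1 - x\<^sup>2))"
  have "complex_of_real x - \<i> * complex_of_real (sqrt (1 - x\<^sup>2)) = cnj z"
    by (simp add: z_def)
  then have "theta_inf k x =
      (if \<bar>x\<bar> < 1 then \<i> / (2 * complex_of_real pi) * (w - cnj w) else 0)"
    if "w = z ^ (k - 1)" for w
    using that by (simp add: theta_inf_def z_def)
  from this[OF refl] show ?thesis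
    by (simp add: complex_is_Real_iff complex_diff_cnj del: complex_cnj_power)
qed

text \<open>The modified Bessel function \<open>K\<^sub>0\<close> for real \<open>z > 0\<close>, by its standard integral
  representation.\<close>

definition bessel_K0 :: "real \<Rightarrow> real" where
  "bessel_K0 z = (LBINT t=0..\<infinity>. exp (- z * cosh t))"

definition F_cut :: "real \<Rightarrow> real" where
  "F_cut x = 1 / (2 * bessel_K0 2) * (LBINT y=ereal x..\<infinity>. exp (- y - 1 / y) / y)"

definition mellin :: "(real \<Rightarrow> complex) \<Rightarrow> complex \<Rightarrow> complex" where
  "mellin g u = (LBINT x=0..\<infinity>. g x * complex_of_real x powr (u - 1))"

text \<open>The upward integral over the line \<open>Re u = \<sigma>\<close>, parametrised by \<open>u = \<sigma> + i \<tau>\<close>,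
  \<open>du = i d\<tau>\<close>.\<close>

definition vline_integral :: "real \<Rightarrow> (complex \<Rightarrow> complex) \<Rightarrow> complex" where
  "vline_integral \<sigma> g = (\<integral>\<tau>. g (Complex \<sigma> \<tau>) * \<i> \<partial>lborel)"

text \<open>The Mellin integral of \<open>F_cut\<close> converges absolutely for \<open>Re u > 0\<close>. Only the line
  \<open>Re u = 1\<close> enters below, so its meromorphic continuation is not needed.\<close>

definition H_cut :: "real \<Rightarrow> complex" where
  "H_cut y = complex_of_real (sqrt pi) / (2 * complex_of_real pi * \<i>) *
     vline_integral 1 (\<lambda>u. Gamma ((1 + u) / 2) / Gamma ((2 - u) / 2) *
       complex_of_real (pi * y) powr (- u) * mellin (\<lambda>x. complex_of_real (F_cut x)) u)"

definition I_int :: "nat \<Rightarrow> nat \<Rightarrow> nat \<Rightarrow> int \<Rightarrow> nat \<Rightarrow> complex" where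
  "I_int k l f \<xi> n =
     (LBINT x=-1..1.
        (let t = real l * real f ^ 2 * (4 * real n) powr (- 1 / 2) / sqrt (1 - x\<^sup>2)
         in theta_inf k x * (complex_of_real (F_cut t) + complex_of_real t * H_cut t) *
            e_add (- x * real_of_int \<xi> * sqrt (real n) / (2 * real l * real f ^ 2))))"

definition kronecker_prime :: "int \<Rightarrow> int \<Rightarrow> int" where
  "kronecker_prime a p =
     (if p = 2 then (if even a then 0 else if a mod 8 = 1 \<or> a mod 8 = 7 then 1 else - 1)
      else Legendre a p)"

definition kronecker :: "int \<Rightarrow> int \<Rightarrow> int" where
  "kronecker a m =
     (if m = 0 then (if \<bar>a\<bar> = 1 then 1 else 0)
      else (if m < 0 \<and> a < 0 then - 1 else 1) *
           (\<Prod>p\<in>#prime_factorization m. kronecker_prime a p))"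

text \<open>The summand depends only on \<open>a\<close> modulo \<open>4 l f\<^sup>2\<close>; the division by \<open>f\<^sup>2\<close> is exact on the
  index set.\<close>

definition Kl_sum :: "nat \<Rightarrow> nat \<Rightarrow> int \<Rightarrow> nat \<Rightarrow> complex" where
  "Kl_sum l f \<xi> n =
     (\<Sum>a\<in>{a \<in> {0..<4 * int l * int f ^ 2}.
            [a ^ 2 = 4 * int n] (mod int f ^ 2) \<and>
            ([(a ^ 2 - 4 * int n) div int f ^ 2 = 0] (mod 4) \<or>
             [(a ^ 2 - 4 * int n) div int f ^ 2 = 1] (mod 4))}.
        of_int (kronecker ((a ^ 2 - 4 * int n) div int f ^ 2) (int l)) *
        e_add (real_of_int a * real_of_int \<xi> / (4 * real l * real f ^ 2)))"

definition S0_index :: "real \<Rightarrow> nat \<Rightarrow> real \<Rightarrow> (nat \<times> nat \<times> int) set" where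
  "S0_index c n \<kappa> =
     {(l, f, \<xi>). l \<ge> 1 \<and> f \<ge> 1 \<and>
        real l * real f ^ 2 * real_of_int \<xi> \<ge> c * real n powr (1 / 2 + \<kappa>)}"

definition S0_term :: "nat \<Rightarrow> nat \<Rightarrow> nat \<times> nat \<times> int \<Rightarrow> complex" where
  "S0_term k n = (\<lambda>(l, f, \<xi>).
     Kl_sum l f \<xi> n / complex_of_real (sqrt (real l)) *
     (I_int k l f \<xi> n / complex_of_real ((real l * real f ^ 2) powr (3 / 2))))"

definition S0 :: "nat \<Rightarrow> real \<Rightarrow> nat \<Rightarrow> real \<Rightarrow> complex" where
  "S0 k c n \<kappa> = (\<Sum>\<^sub>\<infinity>p\<in>S0_index c n \<kappa>. S0_term k n p)"

end

theory Submission
  imports Defs "HOL-Complex_Analysis.Complex_Analysis" "HOL-Probability.Probability"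
    "HOL-Real_Asymp.Real_Asymp"
begin

text \<open>
  Put \<open>L = l f\<^sup>2\<close>, \<open>s = 1 - x\<^sup>2\<close> and \<open>T = L / (2 \<surd>n)\<close>, so that \<open>t = T / \<surd>s\<close>. The weight
  \<open>F t + t H t\<close> and all its iterated Euler derivatives \<open>(t d/dt)\<^sup>j\<close> are \<open>O(t\<^sup>-\<^sup>B)\<close> on the whole half-line
  for every \<open>B \<ge> 0\<close>: for \<open>F\<close> because it integrates \<open>e\<^sup>-\<^sup>y\<^sup>-\<^sup>1\<^sup>/\<^sup>y / y\<close>, for \<open>H\<close> by moving the line of
  integration from \<open>Re u = 1\<close> to \<open>Re u = 1 + B\<close>, where the quotient of Gamma factors grows
  polynomially and the Mellin transform of \<open>F\<close> decays faster than any power.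

  Since \<open>t \<rightarrow> \<infinity>\<close> at \<open>x = \<plusminus>1\<close>, integrating by parts \<open>M\<close> times against the phase of frequency
  \<open>\<eta> = \<xi> \<surd>n / (2 L)\<close> produces no boundary terms and costs at most \<open>s\<^sup>-\<^sup>M\<close>; taking \<open>B = 2 M\<close>
  absorbs this and gives \<open>I = O((\<eta> T\<^sup>2)\<^sup>-\<^sup>M) = O((\<surd>n / (L \<xi>))\<^sup>M)\<close>, uniformly in all parameters.
  With the trivial bound \<open>4 L\<close> for the exponential sum, two of these factors make the triple
  sum converge and each of the others is at most \<open>n\<^sup>-\<^sup>\<kappa> / c\<close> on the range of summation.
\<close>

section \<open>Oscillatory integrals\<close>

text \<open>Uniformity dictates the operator \<open>t d/dt\<close>. Since dt/dx = t x / (1 - x^2),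
  differentiating a function of t in x gives its Euler derivative times x / (1 - x^2), with no trace
  of T; ordinary derivatives would leave powers of t behind. The price is one division by 1 - x^2
  per integration by parts, and decay at infinity pays for it, because t is large exactly where 1 -
  x^2 is small relative to T^2.

  Boundedness as t tends to 0 is the case B = 0. For t H(t) it is read off on the original line,
  where t^(1-u) has modulus 1, so no line to the left of Re u = 1 and no pole of the Mellin
  transform of F comes in.

  To the right of that line the obstacle is the Gamma quotient. Reflection turns it into two Gamma
  values times a sine whose exponential growth they cancel. The polynomial rest is beaten because
  the j-th Euler derivative of F has Mellin transform (-u)^j times that of F, bounded in every strip
  used.

  The two factors reserved for convergence cost n. The remaining ones must therefore save n^(1/2)
  beyond n^(-N \<kappa>), which fixes their number.\<close>

lemma set_integrable_continuous_dominated: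
  fixes f :: "real \<Rightarrow> 'a::{banach, second_countable_topology}" and g :: "real \<Rightarrow> real"
  assumes "open S" "continuous_on S f" "set_integrable lborel S g"
    and "\<And>x. x \<in> S \<Longrightarrow> norm (f x) \<le> g x"
  shows "set_integrable lborel S f"
  unfolding set_integrable_def
proof (rule Bochner_Integration.integrable_bound)
  show "integrable lborel (\<lambda>x. indicator S x *\<^sub>R g x)"
    using assms(3) by (simp add: set_integrable_def)
  show "(\<lambda>x. indicat_real S x *\<^sub>R f x) \<in> borel_measurable lborel"
    using borel_measurable_continuous_on_indicator[OF _ assms(2)] assms(1) by simp
  show "AE x in lborel. norm (indicat_real S x *\<^sub>R f x) \<le> norm (indicat_real S x *\<^sub>R g x)"
    using assms(4) by (intro AE_I2) (force simp: indicator_def)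
qed

lemma norm_set_integral_le:
  fixes f :: "real \<Rightarrow> 'a::{banach, second_countable_topology}" and g :: "real \<Rightarrow> real"
  assumes "set_integrable lborel S f" "set_integrable lborel S g"
    and "\<And>x. x \<in> S \<Longrightarrow> norm (f x) \<le> g x"
  shows "norm (set_lebesgue_integral lborel S f) \<le> set_lebesgue_integral lborel S g"
  unfolding set_lebesgue_integral_def
  by (rule Bochner_Integration.integral_norm_bound_integral)
     (use assms in \<open>auto simp: set_integrable_def indicator_def\<close>)

lemma norm_e_add [simp]: "norm (e_add x) = 1"
proof -
  have "e_add x = exp (\<i> * complex_of_real (2 * pi * x))"
    by (simp add: e_add_def mult_ac)
  then show ?thesis
    using norm_exp_i_times[of "2 * pi * x"] by simp
qed

lemma e_add_has_vector_derivative: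
  "((\<lambda>x. e_add (- (\<eta> * x))) has_vector_derivative
     - (2 * complex_of_real pi * \<i> * complex_of_real \<eta>) * e_add (- (\<eta> * x))) (at x)"
proof -
  have "((\<lambda>x. exp (complex_of_real x * (- (2 * complex_of_real pi * \<i> * complex_of_real \<eta>))))
     has_vector_derivative
     exp (complex_of_real x * (- (2 * complex_of_real pi * \<i> * complex_of_real \<eta>))) *
       (- (2 * complex_of_real pi * \<i> * complex_of_real \<eta>))) (at x)"
    by (rule has_vector_derivative_real_field) (auto intro!: derivative_eq_intros)
  then show ?thesis
    unfolding e_add_def by (simp add: mult_ac)
qed

text \<open>
  \<open>G j\<close> plays the role of \<open>(t d/dt)\<^sup>j G\<close>. The products \<open>x\<^sup>a (1 - x\<^sup>2)\<^sup>b G\<^sub>j(T / \<surd>(1 - x\<^sup>2))\<close> span a space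
  closed under \<open>d/dx\<close>, which makes the repeated integration by parts an induction.
\<close>

locale euler_decay =
  fixes G :: "nat \<Rightarrow> real \<Rightarrow> complex"
  assumes euler_deriv: "t > 0 \<Longrightarrow> (G j has_vector_derivative G (Suc j) t / complex_of_real t) (at t)"
    and decay: "\<exists>C. \<forall>t>0. norm (G j t) * t ^ B \<le> C"
begin

text \<open>The exponent \<open>b\<close> is real because \<open>theta_inf\<close> contributes
  half-integral powers of \<open>1 - x\<^sup>2\<close> and every derivative may lower it by one,
  possibly below zero.\<close>

definition atom :: "nat \<Rightarrow> real \<Rightarrow> nat \<Rightarrow> real \<Rightarrow> real \<Rightarrow> complex" where
  "atom a b j T x = complex_of_real (x ^ a * (1 - x\<^sup>2) powr b) * G j (T / sqrt (1 - x\<^sup>2))"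

text \<open>The last term has coefficient 1 because the chain-rule factor t x / (1 - x^2) cancels
  the division by t in \<open>euler_deriv\<close>. For \<open>a = 0\<close> the truncated
  \<open>a - 1\<close> is harmless, its coefficient being zero.\<close>

definition atom_deriv :: "nat \<Rightarrow> real \<Rightarrow> nat \<Rightarrow> real \<Rightarrow> real \<Rightarrow> complex" where
  "atom_deriv a b j T x = of_nat a * atom (a - 1) b j T x
     - 2 * complex_of_real b * atom (Suc a) (b - 1) j T x + atom (Suc a) (b - 1) (Suc j) T x"

lemma atom_has_vector_derivative:
  assumes "\<bar>x\<bar> < 1" "T > 0"
  shows "(atom a b j T has_vector_derivative atom_deriv a b j T x) (at x)"
proof -
  define s where "s = 1 - x\<^sup>2"
  have s: "s > 0" using assms by (simp add: s_def abs_square_less_1)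
  define p where "p = of_nat a * x ^ (a - 1) * s powr b - 2 * b * x ^ Suc a * s powr (b - 1)"
  have 1: "((\<lambda>x. x ^ a * (1 - x\<^sup>2) powr b) has_real_derivative p) (at x)"
    using s unfolding s_def p_def
    by (auto intro!: derivative_eq_intros simp: powr_diff field_simps)
  then have 1: "((\<lambda>x. complex_of_real (x ^ a * (1 - x\<^sup>2) powr b)) has_vector_derivative complex_of_real p) (at x)"
    by (rule has_vector_derivative_of_real)
  have 2: "((\<lambda>x. T / sqrt (1 - x\<^sup>2)) has_real_derivative (T / sqrt s * x / s)) (at x)"
    using s unfolding s_def
    by (auto intro!: derivative_eq_intros simp: field_simps power2_eq_square)
  have t: "T / sqrt s > 0" using assms s by simp
  have "((G j \<circ> (\<lambda>x. T / sqrt (1 - x\<^sup>2))) has_vector_derivative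
     (T / sqrt s * x / s) *\<^sub>R (G (Suc j) (T / sqrt s) / complex_of_real (T / sqrt s))) (at x)"
    using euler_deriv[OF t] 2
    by (intro vector_diff_chain_at) (auto simp: has_real_derivative_iff_has_vector_derivative s_def)
  moreover have "(T / sqrt s * x / s) *\<^sub>R (G (Suc j) (T / sqrt s) / complex_of_real (T / sqrt s))
      = complex_of_real (x / s) * G (Suc j) (T / sqrt s)"
    using assms s by (simp add: scaleR_conv_of_real field_simps)
  ultimately have 3: "((\<lambda>x. G j (T / sqrt (1 - x\<^sup>2))) has_vector_derivative
     complex_of_real (x / s) * G (Suc j) (T / sqrt s)) (at x)"
    by (simp add: o_def)
  have "((\<lambda>x. complex_of_real (x ^ a * (1 - x\<^sup>2) powr b) * G j (T / sqrt (1 - x\<^sup>2)))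
     has_vector_derivative complex_of_real (x ^ a * (1 - x\<^sup>2) powr b) *
       (complex_of_real (x / s) * G (Suc j) (T / sqrt s)) + complex_of_real p * G j (T / sqrt (1 - x\<^sup>2))) (at x)"
    by (rule has_vector_derivative_mult[OF 1 3])
  also have "complex_of_real (x ^ a * (1 - x\<^sup>2) powr b) *
       (complex_of_real (x / s) * G (Suc j) (T / sqrt s)) + complex_of_real p * G j (T / sqrt (1 - x\<^sup>2))
      = atom_deriv a b j T x"
    using s unfolding atom_deriv_def atom_def p_def s_def[symmetric]
    by (simp add: powr_diff algebra_simps)
  finally show ?thesis
    unfolding atom_def[abs_def] .
qed

lemma continuous_on_atom:
  assumes "T > 0"
  shows "continuous_on {-1<..<1} (atom a b j T)"
  using atom_has_vector_derivative[OF _ assms]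
  by (intro continuous_at_imp_continuous_on ballI)
     (metis abs_less_iff greaterThanLessThan_iff has_vector_derivative_continuous minus_less_iff)

text \<open>Decay in t becomes vanishing at the endpoints: with s = 1 - x^2 one has t^(-B) = T^(-B)
  s^(B/2), and this power of s offsets a negative \<open>b\<close>.\<close>

lemma norm_atom_le:
  "\<exists>C\<ge>0. \<forall>T>0. \<forall>x. \<bar>x\<bar> < 1 \<longrightarrow> norm (atom a b j T x) \<le> C / T ^ B * (1 - x\<^sup>2) powr (b + B / 2)"
proof -
  obtain C where C: "\<And>t. t > 0 \<Longrightarrow> norm (G j t) * t ^ B \<le> C"
    using decay by blast
  have "C \<ge> 0" using C[of 1] by (smt (verit) norm_ge_zero mult_cancel_left2 power_one)
  moreover have "norm (atom a b j T x) \<le> C / T ^ B * (1 - x\<^sup>2) powr (b + B / 2)"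
    if "T > 0" "\<bar>x\<bar> < 1" for T x
  proof -
    define s where "s = 1 - x\<^sup>2"
    have s: "s > 0" using that by (simp add: s_def abs_square_less_1)
    have sB: "sqrt s ^ B = s powr (B / 2)"
      using s by (simp add: powr_half_sqrt[symmetric] powr_powr flip: powr_realpow)
    have "norm (G j (T / sqrt s)) * (T / sqrt s) ^ B \<le> C"
      using C that s by simp
    then have "norm (G j (T / sqrt s)) \<le> C / T ^ B * s powr (B / 2)"
      using that s by (simp add: field_simps sB[symmetric] power_divide)
    moreover have "\<bar>x ^ a\<bar> \<le> 1"
      using that by (simp add: power_abs power_le_one)
    ultimately have "\<bar>x ^ a\<bar> * (s powr b * norm (G j (T / sqrt s))) \<le> 1 * (s powr b * (C / T ^ B * s powr (B / 2)))"
      by (intro mult_mono) auto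
    then show ?thesis
      using s unfolding atom_def s_def[symmetric]
      by (simp add: norm_mult powr_add mult_ac del: of_real_mult of_real_power abs_power_minus)
         (simp add: abs_mult mult_ac)
  qed
  ultimately show ?thesis by blast
qed

lemma norm_atom_le_const:
  assumes "b + B / 2 \<ge> 0"
  shows "\<exists>C\<ge>0. \<forall>T>0. \<forall>x. \<bar>x\<bar> < 1 \<longrightarrow> norm (atom a b j T x) \<le> C / T ^ B"
proof -
  obtain C where C: "C \<ge> 0" "\<And>T x. T > 0 \<Longrightarrow> \<bar>x\<bar> < 1 \<Longrightarrow> norm (atom a b j T x) \<le> C / T ^ B * (1 - x\<^sup>2) powr (b + B / 2)"
    using norm_atom_le[of a b j B] by blast
  have "norm (atom a b j T x) \<le> C / T ^ B" if "T > 0" "\<bar>x\<bar> < 1" for T x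
  proof -
    have "(1 - x\<^sup>2) powr (b + B / 2) \<le> 1"
      using that assms by (intro powr_le1) (auto simp: abs_square_le_1)
    then have "C / T ^ B * (1 - x\<^sup>2) powr (b + B / 2) \<le> C / T ^ B * 1"
      using C(1) that by (intro mult_left_mono) auto
    then show ?thesis
      using C(2)[OF that] by linarith
  qed
  with C(1) show ?thesis by blast
qed

lemma set_integrable_atom:
  assumes "T > 0"
  shows "set_integrable lborel {-1<..<1} (\<lambda>x. atom a b j T x * e_add (- (\<eta> * x)))"
proof -
  \<comment> \<open>Any decay order with b + B/2 nonnegative makes the atom bounded on the
    interval.\<close>
  define B where "B = nat \<lceil>2 * \<bar>b\<bar>\<rceil>"
  have B: "b + B / 2 \<ge> 0" unfolding B_def by linarith
  obtain C where C: "\<And>x. \<bar>x\<bar> < 1 \<Longrightarrow> norm (atom a b j T x) \<le> C / T ^ B"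
    using norm_atom_le_const[OF B, of a j] assms by blast
  have "continuous_on {-1<..<1} (\<lambda>x. atom a b j T x * e_add (- (\<eta> * x)))"
    by (intro continuous_intros continuous_on_atom assms continuous_at_imp_continuous_on ballI
         has_vector_derivative_continuous[OF e_add_has_vector_derivative])
  moreover have "set_integrable lborel {-1<..<(1::real)} (\<lambda>_. C / T ^ B)"
    by (simp add: set_integrable_def)
  moreover have "norm (atom a b j T x * e_add (- (\<eta> * x))) \<le> C / T ^ B" if "x \<in> {-1<..<1}" for x
    using C[of x] that by (simp add: norm_mult abs_less_iff)
  ultimately show ?thesis
    by (rule set_integrable_continuous_dominated[OF open_greaterThanLessThan])
qed

definition osc_integral :: "nat \<Rightarrow> real \<Rightarrow> nat \<Rightarrow> real \<Rightarrow> real \<Rightarrow> complex" where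
  "osc_integral a b j T \<eta> = (LBINT x:{-1<..<1}. atom a b j T x * e_add (- (\<eta> * x)))"

lemma norm_osc_integral_le_trivial:
  assumes "b + B / 2 \<ge> 0"
  shows "\<exists>C\<ge>0. \<forall>T>0. \<forall>\<eta>. norm (osc_integral a b j T \<eta>) \<le> C / T ^ B"
proof -
  obtain C where C: "C \<ge> 0" "\<And>T x. T > 0 \<Longrightarrow> \<bar>x\<bar> < 1 \<Longrightarrow> norm (atom a b j T x) \<le> C / T ^ B"
    using norm_atom_le_const[OF assms, of a j] by blast
  have "norm (osc_integral a b j T \<eta>) \<le> (2 * C) / T ^ B" if T: "T > 0" for T \<eta>
  proof -
    have "norm (atom a b j T x * e_add (- (\<eta> * x))) \<le> C / T ^ B" if "x \<in> {-1<..<1}" for x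
      using C(2)[OF T, of x] that by (simp add: norm_mult abs_less_iff)
    then have "norm (osc_integral a b j T \<eta>) \<le> (LBINT x:{-1<..<(1::real)}. C / T ^ B)"
      unfolding osc_integral_def
      by (rule norm_set_integral_le[OF set_integrable_atom[OF T], rotated]) (simp_all add: set_integrable_def)
    then show ?thesis
      by (simp add: set_lebesgue_integral_def)
  qed
  with C(1) show ?thesis
    by (intro exI[of _ "2 * C"]) auto
qed

lemma osc_integral_by_parts:
  assumes T: "T > 0"
  shows "2 * complex_of_real pi * \<i> * complex_of_real \<eta> * osc_integral a b j T \<eta> =
     of_nat a * osc_integral (a - 1) b j T \<eta>
     - 2 * complex_of_real b * osc_integral (Suc a) (b - 1) j T \<eta>
     + osc_integral (Suc a) (b - 1) (Suc j) T \<eta>"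
proof -
  define e where "e = (\<lambda>x. e_add (- (\<eta> * x)))"
  define c where "c = 2 * complex_of_real pi * \<i> * complex_of_real \<eta>"
  \<comment> \<open>This is the exact derivative of \<open>atom a b j T x * e x\<close>, so its
    integral consists of boundary terms only.\<close>
  define f where "f = (\<lambda>x. (of_nat a * (atom (a - 1) b j T x * e x)
     - 2 * complex_of_real b * (atom (Suc a) (b - 1) j T x * e x)
     + atom (Suc a) (b - 1) (Suc j) T x * e x) - c * (atom a b j T x * e x))"
  have ei: "einterval (-1) 1 = {-1<..<1::real}"
    by (auto simp: einterval_def one_ereal_def)
  have int: "set_integrable lborel {-1<..<1} (\<lambda>x. atom a b j T x * e x)" for a b j
    unfolding e_def by (rule set_integrable_atom[OF T])
  have fi: "set_integrable lborel {-1<..<1} f"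
    unfolding f_def
    by (intro set_integral_diff set_integral_add set_integrable_mult_right int)
  have e_cont: "continuous_on A e" for A
    unfolding e_def
    by (intro continuous_at_imp_continuous_on ballI has_vector_derivative_continuous[OF e_add_has_vector_derivative])
  have f_cont: "continuous_on {-1<..<1} f"
    unfolding f_def by (intro continuous_intros continuous_on_atom T e_cont)
  \<comment> \<open>The extra 1 makes the exponent b + B/2 strictly positive, so that the bound
    tends to 0 at both endpoints. This \<open>B\<close> serves the boundary terms only.\<close>
  define B where "B = nat \<lceil>2 * \<bar>b\<bar>\<rceil> + 1"
  have "real B \<ge> 2 * \<bar>b\<bar> + 1" unfolding B_def by simp
  then have B: "b + B / 2 > 0" by linarith
  obtain C where C: "C \<ge> 0" "\<And>x. \<bar>x\<bar> < 1 \<Longrightarrow> norm (atom a b j T x) \<le> C / T ^ B * (1 - x\<^sup>2) powr (b + B / 2)"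
    using norm_atom_le[of a b j B] assms by blast
  have nb: "norm (atom a b j T x * e x) \<le> C / T ^ B * (1 - x\<^sup>2) powr (b + B / 2)" if "\<bar>x\<bar> < 1" for x
    using C(2)[OF that] by (simp add: e_def norm_mult)
  have lim: "((\<lambda>x. atom a b j T x * e x) \<longlongrightarrow> 0) F"
    if "eventually (\<lambda>x. \<bar>x\<bar> < 1) F" "((\<lambda>x. 1 - x\<^sup>2) \<longlongrightarrow> 0) F" for F
  proof (rule Lim_null_comparison)
    show "eventually (\<lambda>x. norm (atom a b j T x * e x) \<le> C / T ^ B * (1 - x\<^sup>2) powr (b + B / 2)) F"
      using that(1) by eventually_elim (rule nb)
    have "((\<lambda>x. (1 - x\<^sup>2) powr (b + B / 2)) \<longlongrightarrow> 0 powr (b + B / 2)) F"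
      using that(2) tendsto_const
    proof (rule tendsto_powr2)
      show "eventually (\<lambda>x. 0 \<le> 1 - x\<^sup>2) F"
        using that(1) by eventually_elim (simp add: abs_square_le_1)
    qed (use B in simp)
    then show "((\<lambda>x. C / T ^ B * (1 - x\<^sup>2) powr (b + B / 2)) \<longlongrightarrow> 0) F"
      by (intro tendsto_mult_right_zero) simp
  qed
  have "(LBINT x=-1..1. f x) = 0 - 0"
  proof (rule interval_integral_FTC_integrable[where F = "\<lambda>x. atom a b j T x * e x"])
    fix x assume "(-1::ereal) < ereal x" "ereal x < 1"
    then have x: "-1 < x" "x < 1" by (simp_all add: one_ereal_def)
    have "((\<lambda>x. atom a b j T x * e x) has_vector_derivative
        atom a b j T x * (- c * e x) + atom_deriv a b j T x * e x) (at x)"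
      unfolding e_def c_def
      using x T by (intro has_vector_derivative_mult atom_has_vector_derivative e_add_has_vector_derivative) auto
    moreover have "atom a b j T x * (- c * e x) + atom_deriv a b j T x * e x = f x"
      by (simp add: f_def atom_deriv_def algebra_simps)
    ultimately show "((\<lambda>x. atom a b j T x * e x) has_vector_derivative f x) (at x)"
      by simp
    show "isCont f x"
      using f_cont x by (simp add: continuous_on_eq_continuous_at)
  next
    show "(((\<lambda>x. atom a b j T x * e x) \<circ> real_of_ereal) \<longlongrightarrow> 0) (at_right (-1))"
      unfolding one_ereal_def uminus_ereal.simps ereal_tendsto_simps
      by (rule lim) (auto intro!: tendsto_eq_intros eventually_at_rightI[of _ 1])
    show "(((\<lambda>x. atom a b j T x * e x) \<circ> real_of_ereal) \<longlongrightarrow> 0) (at_left 1)"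
      unfolding one_ereal_def uminus_ereal.simps ereal_tendsto_simps
      by (rule lim) (auto intro!: tendsto_eq_intros eventually_at_leftI[of "-1"])
  qed (use fi ei in \<open>auto simp: one_ereal_def\<close>)
  then have "(LBINT x:{-1<..<1}. f x) = 0"
    unfolding interval_lebesgue_integral_def ei by (simp add: one_ereal_def)
  moreover have "(LBINT x:{-1<..<1}. f x) = (of_nat a * osc_integral (a - 1) b j T \<eta>
     - 2 * complex_of_real b * osc_integral (Suc a) (b - 1) j T \<eta>
     + osc_integral (Suc a) (b - 1) (Suc j) T \<eta>) - c * osc_integral a b j T \<eta>"
    unfolding f_def osc_integral_def e_def[THEN fun_cong, symmetric]
    by (simp add: set_integral_diff set_integral_add set_integrable_mult_right int)
  ultimately show ?thesis
    by (simp add: c_def)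
qed

text \<open>Each integration by parts gains a factor 1 / (2 \<pi> \<eta>) and lowers
  \<open>b\<close> by at most one. The hypothesis keeps B/2 in reserve for \<open>M\<close> such
  steps, so the trivial bound still applies at the end. The induction must generalise
  \<open>a\<close>, \<open>b\<close> and \<open>j\<close>, since every step changes them.\<close>

lemma norm_osc_integral_le:
  assumes "b - real M + B / 2 \<ge> 0"
  shows "\<exists>C\<ge>0. \<forall>T>0. \<forall>\<eta>>0. norm (osc_integral a b j T \<eta>) \<le> C / (\<eta> ^ M * T ^ B)"
  using assms
proof (induction M arbitrary: a b j)
  case 0
  then obtain C where "C \<ge> 0" "\<forall>T>0. \<forall>\<eta>. norm (osc_integral a b j T \<eta>) \<le> C / T ^ B"
    using norm_osc_integral_le_trivial[of b B a j] by auto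
  then show ?case by (intro exI[of _ C]) auto
next
  case (Suc M)
  have 1: "b - real M + B / 2 \<ge> 0" and 2: "(b - 1) - real M + B / 2 \<ge> 0"
    using Suc.prems by auto
  obtain C1 where C1: "C1 \<ge> 0" "\<And>T \<eta>. T > 0 \<Longrightarrow> \<eta> > 0 \<Longrightarrow> norm (osc_integral (a - 1) b j T \<eta>) \<le> C1 / (\<eta> ^ M * T ^ B)"
    using Suc.IH[OF 1, of "a - 1" j] by blast
  obtain C2 where C2: "C2 \<ge> 0" "\<And>T \<eta>. T > 0 \<Longrightarrow> \<eta> > 0 \<Longrightarrow> norm (osc_integral (Suc a) (b - 1) j T \<eta>) \<le> C2 / (\<eta> ^ M * T ^ B)"
    using Suc.IH[OF 2, of "Suc a" j] by blast
  obtain C3 where C3: "C3 \<ge> 0" "\<And>T \<eta>. T > 0 \<Longrightarrow> \<eta> > 0 \<Longrightarrow> norm (osc_integral (Suc a) (b - 1) (Suc j) T \<eta>) \<le> C3 / (\<eta> ^ M * T ^ B)"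
    using Suc.IH[OF 2, of "Suc a" "Suc j"] by blast
  define C where "C = (real a * C1 + 2 * \<bar>b\<bar> * C2 + C3) / (2 * pi)"
  have "norm (osc_integral a b j T \<eta>) \<le> C / (\<eta> ^ Suc M * T ^ B)" if "T > 0" "\<eta> > 0" for T \<eta>
  proof -
    let ?D = "\<eta> ^ M * T ^ B"
    have "2 * pi * \<eta> * norm (osc_integral a b j T \<eta>) =
        norm (2 * complex_of_real pi * \<i> * complex_of_real \<eta> * osc_integral a b j T \<eta>)"
      using that by (simp add: norm_mult)
    also have "\<dots> \<le> norm (of_nat a * osc_integral (a - 1) b j T \<eta>)
      + norm (2 * complex_of_real b * osc_integral (Suc a) (b - 1) j T \<eta>)
      + norm (osc_integral (Suc a) (b - 1) (Suc j) T \<eta>)"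
      unfolding osc_integral_by_parts[OF that(1)]
      by (rule norm_triangle_le) (rule add_mono[OF norm_triangle_ineq4 order_refl])
    also have "\<dots> \<le> real a * (C1 / ?D) + 2 * \<bar>b\<bar> * (C2 / ?D) + C3 / ?D"
      using C1(2)[OF that] C2(2)[OF that] C3(2)[OF that]
      by (simp only: norm_mult norm_of_nat norm_of_real norm_numeral, intro add_mono mult_left_mono) auto
    also have "\<dots> = 2 * pi * C / ?D"
      unfolding C_def by (simp flip: add_divide_distrib)
    finally show ?thesis
      using that by (simp add: field_simps)
  qed
  moreover have "C \<ge> 0" using C1(1) C2(1) C3(1) by (simp add: C_def)
  ultimately show ?case by blast
qed

end

section \<open>Gamma factors in vertical strips\<close>

text \<open>
  Termwise in the Euler product, \<open>\<bar>\<Gamma>(\<sigma> + i y)\<bar> / \<Gamma>(\<sigma>)\<close> is increasing in \<open>\<sigma>\<close>. This reduces a vertical strip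
  to a line with integral abscissa, where the reflection formula is explicit, and so replaces
  Stirling's formula.
\<close>

lemma norm_Gamma_complex_mono:
  fixes y :: real
  assumes "0 < \<sigma>" "\<sigma> \<le> \<sigma>'"
  shows "norm (Gamma (Complex \<sigma> y)) * Gamma \<sigma>' \<le> norm (Gamma (Complex \<sigma>' y)) * Gamma \<sigma>"
proof (rule LIMSEQ_le)
  show "(\<lambda>n. norm (Gamma_series (Complex \<sigma> y) n) * Gamma_series \<sigma>' n) \<longlonglongrightarrow> norm (Gamma (Complex \<sigma> y)) * Gamma \<sigma>'"
    by (intro tendsto_intros)
  show "(\<lambda>n. norm (Gamma_series (Complex \<sigma>' y) n) * Gamma_series \<sigma> n) \<longlonglongrightarrow> norm (Gamma (Complex \<sigma>' y)) * Gamma \<sigma>"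
    by (intro tendsto_intros)
  \<comment> \<open>Pochhammer symbols are the denominators of \<open>Gamma_series\<close>, hence
    the reversed sense. After squaring one factor, the common terms cancel and y^2 (\<sigma> + n)^2
    \<le> y^2 (\<sigma>' + n)^2 remains.\<close>
  have poch: "norm (pochhammer (Complex \<sigma>' y) n) * pochhammer \<sigma> n \<le> norm (pochhammer (Complex \<sigma> y) n) * pochhammer \<sigma>' n" for n
  proof (induction n)
    case (Suc n)
    have "norm (Complex \<sigma>' y + of_nat n) * (\<sigma> + n) \<le> norm (Complex \<sigma> y + of_nat n) * (\<sigma>' + n)"
    proof (rule power2_le_imp_le)
      have "(\<sigma> + n)\<^sup>2 \<le> (\<sigma>' + n)\<^sup>2" using assms by (intro power_mono) auto
      then have "((\<sigma>' + n)\<^sup>2 + y\<^sup>2) * (\<sigma> + n)\<^sup>2 \<le> ((\<sigma> + n)\<^sup>2 + y\<^sup>2) * (\<sigma>' + n)\<^sup>2"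
        by (simp add: algebra_simps mult_left_mono)
      then show "(norm (Complex \<sigma>' y + of_nat n) * (\<sigma> + n))\<^sup>2 \<le> (norm (Complex \<sigma> y + of_nat n) * (\<sigma>' + n))\<^sup>2"
        by (simp add: power_mult_distrib cmod_power2)
    qed (use assms in auto)
    then have "(norm (pochhammer (Complex \<sigma>' y) n) * pochhammer \<sigma> n) * (norm (Complex \<sigma>' y + of_nat n) * (\<sigma> + n))
      \<le> (norm (pochhammer (Complex \<sigma> y) n) * pochhammer \<sigma>' n) * (norm (Complex \<sigma> y + of_nat n) * (\<sigma>' + n))"
      using assms by (intro mult_mono[OF Suc.IH]) (auto intro!: mult_nonneg_nonneg pochhammer_nonneg)
    then show ?case
      by (simp add: pochhammer_Suc norm_mult mult_ac)
  qed simp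
  show "\<exists>N. \<forall>n\<ge>N. norm (Gamma_series (Complex \<sigma> y) n) * Gamma_series \<sigma>' n \<le> norm (Gamma_series (Complex \<sigma>' y) n) * Gamma_series \<sigma> n"
  proof (intro exI allI impI)
    fix n :: nat assume "n \<ge> 1"
    have nz: "pochhammer (Complex s y) (Suc n) \<noteq> 0" if "s > 0" for s
      using that unfolding pochhammer_eq_0_iff by (auto simp: complex_eq_iff)
    have pos: "pochhammer s (Suc n) > 0" if "s > 0" for s :: real
      using that by (intro pochhammer_pos)
    define K where "K = (fact n :: real)\<^sup>2 * exp (\<sigma> * ln n) * exp (\<sigma>' * ln n)"
    have 1: "norm (Gamma_series (Complex s y) n) * Gamma_series s' n =
      ((fact n :: real)\<^sup>2 * exp (s * ln n) * exp (s' * ln n)) / (norm (pochhammer (Complex s y) (n + 1)) * pochhammer s' (n + 1))" for s s'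
      by (simp add: Gamma_series_def norm_mult norm_divide power2_eq_square)
    have "K / (norm (pochhammer (Complex \<sigma> y) (n + 1)) * pochhammer \<sigma>' (n + 1)) \<le>
       K / (norm (pochhammer (Complex \<sigma>' y) (n + 1)) * pochhammer \<sigma> (n + 1))"
      using assms by (intro divide_left_mono poch mult_pos_pos) (auto simp: K_def nz pos simp del: pochhammer_Suc)
    then show "norm (Gamma_series (Complex \<sigma> y) n) * Gamma_series \<sigma>' n \<le> norm (Gamma_series (Complex \<sigma>' y) n) * Gamma_series \<sigma> n"
      unfolding 1 K_def by (simp add: mult_ac)
  qed
qed

text \<open>Reflection gives |\<Gamma>(1 + i y)|^2 = \<pi> |y| / sinh(\<pi> |y|). Multiplied by the
  exponential this is w / (1 - e^(-w)) with w = 2 \<pi> |y|, and it is at most 1 + w because e^w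
  \<ge> 1 + w. The case y = 0 stands apart because \<Gamma>(1 + z) = z \<Gamma>(z) fails at the
  pole.\<close>

lemma norm_Gamma_one_plus_imaginary:
  "(norm (Gamma (Complex 1 y)))\<^sup>2 * exp (pi * \<bar>y\<bar>) \<le> 1 + 2 * pi * \<bar>y\<bar>"
proof (cases "y = 0")
  case True
  then have "Complex 1 y = 1" by (simp add: complex_eq_iff)
  then show ?thesis using True by simp
next
  case False
  define z where "z = \<i> * complex_of_real y"
  have z: "z \<noteq> 0" using False by (simp add: z_def)
  have "z \<notin> \<int>\<^sub>\<le>\<^sub>0"
    using False by (auto simp: z_def complex_eq_iff elim!: nonpos_Ints_cases)
  then have G1: "Gamma (1 + z) = z * Gamma z"
    by (metis Gamma_plus1 add.commute)
  have cz: "cnj (1 + z) = 1 - z" by (simp add: z_def complex_eq_iff)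
  have "norm (Gamma (1 - z)) = norm (Gamma (1 + z))"
    by (metis cz cnj_Gamma complex_mod_cnj)
  then have "(norm (Gamma (1 + z)))\<^sup>2 = norm (z * (Gamma z * Gamma (1 - z)))"
    by (simp add: power2_eq_square norm_mult G1)
  also have "\<dots> = norm (z * (of_real pi / sin (of_real pi * z)))"
    by (simp only: Gamma_reflection_complex)
  also have "\<dots> = \<bar>y\<bar> * pi / norm (sin (of_real pi * z))"
    by (simp add: norm_mult norm_divide z_def)
  also have "norm (sin (of_real pi * z)) = (exp (pi * \<bar>y\<bar>) - exp (- (pi * \<bar>y\<bar>))) / 2"
  proof -
    have "(norm (sin (of_real pi * z)))\<^sup>2 = ((exp (pi * \<bar>y\<bar>) - exp (- (pi * \<bar>y\<bar>))) / 2)\<^sup>2"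
    proof -
      have "(norm (sin (of_real pi * z)))\<^sup>2 = (exp (2 * (pi * y)) + inverse (exp (2 * (pi * y))) - 2) / 4"
        unfolding norm_sin_squared by (simp add: z_def)
      also have "\<dots> = ((exp (pi * y) - inverse (exp (pi * y))) / 2)\<^sup>2"
        unfolding exp_double by (simp add: field_simps power2_eq_square)
      also have "\<dots> = ((exp (pi * \<bar>y\<bar>) - exp (- (pi * \<bar>y\<bar>))) / 2)\<^sup>2"
        by (cases "y \<ge> 0") (simp_all add: exp_minus power_divide power2_commute)
      finally show ?thesis .
    qed
    then show ?thesis
      by (subst (asm) power2_eq_iff_nonneg) auto
  qed
  finally have eq: "(norm (Gamma (1 + z)))\<^sup>2 = \<bar>y\<bar> * pi / ((exp (pi * \<bar>y\<bar>) - exp (- (pi * \<bar>y\<bar>))) / 2)" .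
  define w where "w = 2 * pi * \<bar>y\<bar>"
  have w: "w > 0" using False by (simp add: w_def)
  have e1: "exp (- w) \<le> 1 / (1 + w)"
    using exp_ge_add_one_self[of w] w by (simp add: exp_minus field_simps)
  have e2: "exp (pi * \<bar>y\<bar>) - exp (- (pi * \<bar>y\<bar>)) = exp (pi * \<bar>y\<bar>) * (1 - exp (- w))"
    by (simp add: w_def algebra_simps flip: exp_add)
  have "(norm (Gamma (1 + z)))\<^sup>2 * exp (pi * \<bar>y\<bar>) = w / (1 - exp (- w))"
    unfolding eq e2 by (simp add: w_def)
  also have "\<dots> \<le> w / (1 - 1 / (1 + w))"
    using w e1 by (intro divide_left_mono) (auto simp: field_simps intro!: mult_pos_pos)
  also have "\<dots> = 1 + w"
    using w by (simp add: field_simps)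
  also have "1 + z = Complex 1 y" by (simp add: z_def complex_eq_iff)
  finally show ?thesis by (simp add: w_def)
qed

text \<open>Each use of \<Gamma>(z + 1) = z \<Gamma>(z) costs one power of 1 + |y|. The base case
  would allow the exponent 1/2; it is rounded up to 1 to keep the exponents integral.\<close>

lemma norm_Gamma_vertical_line:
  "\<exists>C\<ge>0. \<forall>y. norm (Gamma (Complex (real m + 1) y)) * exp (pi * \<bar>y\<bar> / 2) \<le> C * (1 + \<bar>y\<bar>) ^ (m + 1)"
proof (induction m)
  case 0
  have "norm (Gamma (Complex 1 y)) * exp (pi * \<bar>y\<bar> / 2) \<le> 2 * pi * (1 + \<bar>y\<bar>)" for y
  proof (rule power2_le_imp_le)
    have ge1: "2 * pi * (1 + \<bar>y\<bar>) \<ge> 1 + 2 * pi * \<bar>y\<bar>"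
      using pi_gt3 by (simp add: algebra_simps)
    then have ge1': "2 * pi * (1 + \<bar>y\<bar>) \<ge> 1"
      by (smt (verit) mult_nonneg_nonneg pi_ge_zero abs_ge_zero)
    have "(norm (Gamma (Complex 1 y)) * exp (pi * \<bar>y\<bar> / 2))\<^sup>2 = (norm (Gamma (Complex 1 y)))\<^sup>2 * exp (pi * \<bar>y\<bar>)"
      by (simp add: power_mult_distrib flip: exp_double)
    also have "\<dots> \<le> 2 * pi * (1 + \<bar>y\<bar>)"
      using norm_Gamma_one_plus_imaginary[of y] ge1 by linarith
    also have "\<dots> \<le> (2 * pi * (1 + \<bar>y\<bar>))\<^sup>2"
      using ge1' by (rule self_le_power) simp
    finally show "(norm (Gamma (Complex 1 y)) * exp (pi * \<bar>y\<bar> / 2))\<^sup>2 \<le> (2 * pi * (1 + \<bar>y\<bar>))\<^sup>2" .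
  qed auto
  then show ?case
    by (intro exI[of _ "2 * pi"]) auto
next
  case (Suc m)
  then obtain C where C: "C \<ge> 0" "\<And>y. norm (Gamma (Complex (real m + 1) y)) * exp (pi * \<bar>y\<bar> / 2) \<le> C * (1 + \<bar>y\<bar>) ^ (m + 1)"
    by blast
  have "norm (Gamma (Complex (real (Suc m) + 1) y)) * exp (pi * \<bar>y\<bar> / 2)
      \<le> (real m + 1) * C * (1 + \<bar>y\<bar>) ^ (Suc m + 1)" for y
  proof -
    define z where "z = Complex (real m + 1) y"
    have "z \<notin> \<int>\<^sub>\<le>\<^sub>0"
      by (auto simp: z_def complex_eq_iff elim!: nonpos_Ints_cases)
    then have "Gamma (z + 1) = z * Gamma z" by (rule Gamma_plus1)
    moreover have "z + 1 = Complex (real (Suc m) + 1) y"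
      by (simp add: z_def complex_eq_iff)
    ultimately have eq: "Gamma (Complex (real (Suc m) + 1) y) = z * Gamma z" by simp
    have "norm z \<le> \<bar>real m + 1\<bar> + \<bar>y\<bar>"
      using cmod_le[of z] by (simp add: z_def)
    also have "\<dots> \<le> (real m + 1) * (1 + \<bar>y\<bar>)"
      by (simp add: algebra_simps)
    finally have "norm z * (norm (Gamma z) * exp (pi * \<bar>y\<bar> / 2)) \<le> ((real m + 1) * (1 + \<bar>y\<bar>)) * (C * (1 + \<bar>y\<bar>) ^ (m + 1))"
      using C(1) C(2)[of y] by (intro mult_mono[where b = "_ * _"]) (auto simp: z_def)
    then show ?thesis
      unfolding eq norm_mult by (simp add: mult_ac)
  qed
  then show ?case
    using C(1) by (intro exI[of _ "(real m + 1) * C"]) auto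
qed

lemma norm_Gamma_vertical_strip:
  assumes "a > 0"
  shows "\<exists>C\<ge>0. \<forall>\<sigma> y. a \<le> \<sigma> \<longrightarrow> \<sigma> \<le> real m + 1 \<longrightarrow>
     norm (Gamma (Complex \<sigma> y)) * exp (pi * \<bar>y\<bar> / 2) \<le> C * (1 + \<bar>y\<bar>) ^ (m + 1)"
proof -
  obtain C where C: "C \<ge> 0" "\<And>y. norm (Gamma (Complex (real m + 1) y)) * exp (pi * \<bar>y\<bar> / 2) \<le> C * (1 + \<bar>y\<bar>) ^ (m + 1)"
    using norm_Gamma_vertical_line by blast
  have "continuous_on {a..real m + 1} (Gamma :: real \<Rightarrow> real)"
    using assms by (intro continuous_on_Gamma) (auto elim!: nonpos_Ints_cases)
  then have "bounded (Gamma ` {a..real m + 1})"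
    by (intro compact_imp_bounded compact_continuous_image) auto
  then obtain D where D: "D > 0" "\<And>\<sigma>. \<sigma> \<in> {a..real m + 1} \<Longrightarrow> \<bar>Gamma \<sigma>\<bar> \<le> D"
    unfolding bounded_pos by auto
  have "norm (Gamma (Complex \<sigma> y)) * exp (pi * \<bar>y\<bar> / 2) \<le> D * C * (1 + \<bar>y\<bar>) ^ (m + 1)"
    if "a \<le> \<sigma>" "\<sigma> \<le> real m + 1" for \<sigma> y
  proof -
    have "Gamma (real m + 1) = fact m"
      by (metis Gamma_fact add.commute of_nat_fact)
    then have "1 \<le> Gamma (real m + 1)"
      by simp
    then have "norm (Gamma (Complex \<sigma> y)) * 1 \<le> norm (Gamma (Complex \<sigma> y)) * Gamma (real m + 1)"
      by (intro mult_left_mono) auto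
    also have "\<dots> \<le> norm (Gamma (Complex (real m + 1) y)) * Gamma \<sigma>"
      using that assms by (intro norm_Gamma_complex_mono) auto
    also have "\<dots> \<le> norm (Gamma (Complex (real m + 1) y)) * D"
      using that D(2)[of \<sigma>] by (intro mult_left_mono) auto
    finally have "norm (Gamma (Complex \<sigma> y)) * exp (pi * \<bar>y\<bar> / 2) \<le>
        D * (norm (Gamma (Complex (real m + 1) y)) * exp (pi * \<bar>y\<bar> / 2))"
      by (simp add: mult_ac)
    also have "\<dots> \<le> D * (C * (1 + \<bar>y\<bar>) ^ (m + 1))"
      using D(1) by (intro mult_left_mono C) auto
    finally show ?thesis by (simp add: mult_ac)
  qed
  then show ?thesis
    using C(1) D(1) by (intro exI[of _ "D * C"]) auto
qed

section \<open>The quotient of Gamma factors\<close>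

lemma norm_sin_le_exp_Im: "norm (sin z) \<le> exp \<bar>Im z\<bar>"
proof (rule power2_le_imp_le)
  have 1: "exp (2 * Im z) \<le> exp (2 * \<bar>Im z\<bar>)" "inverse (exp (2 * Im z)) \<le> exp (2 * \<bar>Im z\<bar>)"
    by (simp_all flip: exp_minus)
  have 2: "1 \<le> exp (2 * \<bar>Im z\<bar>)" by simp
  have 3: "- cos (2 * Re z) \<le> 1" using cos_ge_minus_one[of "2 * Re z"] by linarith
  have "(norm (sin z))\<^sup>2 \<le> exp (2 * \<bar>Im z\<bar>)"
  proof -
    have "(a + b - 2 * c) / 4 \<le> X" if "a \<le> X" "b \<le> X" "1 \<le> X" "- c \<le> 1" for a b c X :: real
      using that by simp
    from this[OF 1 2 3] show ?thesis unfolding norm_sin_squared .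
  qed
  then show "(norm (sin z))\<^sup>2 \<le> (exp \<bar>Im z\<bar>)\<^sup>2" by (simp flip: exp_double)
qed simp

definition gamma_ratio :: "complex \<Rightarrow> complex" where
  "gamma_ratio u = Gamma ((1 + u) / 2) / Gamma ((2 - u) / 2)"

text \<open>The denominator has poles at u = 2, 4, and so on. There \<open>Gamma\<close> takes the
  value 0, and dividing by it yields 0, which is the value of the entire function
  \<open>rGamma\<close>; the quotient as written is thus holomorphic without exceptions.\<close>

lemma gamma_ratio_holomorphic: "gamma_ratio holomorphic_on {u. Re u > 0}"
proof -
  have "(\<lambda>u. Gamma ((1 + u) / 2) * rGamma ((2 - u) / 2)) holomorphic_on {u. Re u > 0}"
    by (intro holomorphic_intros) (auto simp: complex_eq_iff elim!: nonpos_Ints_cases)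
  then show ?thesis
    by (simp only: gamma_ratio_def[abs_def] rGamma_inverse_Gamma divide_inverse)
qed

text \<open>By reflection 1 / \<Gamma>(1 - u/2) = \<Gamma>(u/2) sin(\<pi> u/2) / \<pi>. With y = Im
  u / 2 each of the two Gamma values decays like e^(-\<pi> |y| / 2) and the sine grows at most like
  e^(\<pi> |y|), so only powers survive.\<close>

lemma norm_gamma_ratio_le:
  "\<exists>C\<ge>0. \<forall>u. 1 \<le> Re u \<longrightarrow> Re u \<le> real m \<longrightarrow> norm (gamma_ratio u) \<le> C * norm u ^ (2 * m + 2)"
proof -
  \<comment> \<open>The arguments (1 + u)/2 and u/2 both have real part at least 1/2 and at most m +
    1.\<close>
  obtain C where C: "C \<ge> 0" "\<And>\<sigma> y. 1 / 2 \<le> \<sigma> \<Longrightarrow> \<sigma> \<le> real m + 1 \<Longrightarrow>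
     norm (Gamma (Complex \<sigma> y)) * exp (pi * \<bar>y\<bar> / 2) \<le> C * (1 + \<bar>y\<bar>) ^ (m + 1)"
    using norm_Gamma_vertical_strip[of "1 / 2" m] by auto
  have "norm (gamma_ratio u) \<le> C\<^sup>2 * 2 ^ (2 * m + 2) * norm u ^ (2 * m + 2)" if u: "1 \<le> Re u" "Re u \<le> real m" for u
  proof -
    define y where "y = Im u / 2"
    have c1: "(1 + u) / 2 = Complex ((1 + Re u) / 2) y" and c2: "u / 2 = Complex (Re u / 2) y"
      by (simp_all add: complex_eq_iff y_def)
    have "u / 2 \<notin> \<int>\<^sub>\<le>\<^sub>0"
      using u by (auto simp: complex_eq_iff elim!: nonpos_Ints_cases)
    then have nz: "rGamma (u / 2) \<noteq> 0" by (simp add: rGamma_eq_zero_iff)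
    have "rGamma (1 - u / 2) = inverse (rGamma (u / 2)) * (rGamma (u / 2) * rGamma (1 - u / 2))"
      using nz by simp
    also have "\<dots> = Gamma (u / 2) * (sin (of_real pi * (u / 2)) / of_real pi)"
      by (simp only: rGamma_reflection_complex Gamma_def)
    also have "1 - u / 2 = (2 - u) / 2" by (simp add: field_simps)
    finally have "rGamma ((2 - u) / 2) = Gamma (u / 2) * (sin (of_real pi * (u / 2)) / of_real pi)" .
    then have eq: "gamma_ratio u = Gamma ((1 + u) / 2) * (Gamma (u / 2) * (sin (of_real pi * (u / 2)) / of_real pi))"
      by (simp only: gamma_ratio_def rGamma_inverse_Gamma divide_inverse)
    have s: "norm (sin (of_real pi * (u / 2)) / of_real pi) \<le> exp (pi * \<bar>y\<bar>)"
    proof -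
      have "norm (sin (of_real pi * (u / 2))) \<le> exp (pi * \<bar>y\<bar>)"
        using norm_sin_le_exp_Im[of "of_real pi * (u / 2)"] by (simp add: y_def abs_mult)
      moreover have "norm (sin (of_real pi * (u / 2)) / of_real pi) \<le> norm (sin (of_real pi * (u / 2))) / 1"
        unfolding norm_divide using pi_gt3 by (intro divide_left_mono) auto
      ultimately show ?thesis by simp
    qed
    have "norm (gamma_ratio u) \<le> norm (Gamma ((1 + u) / 2)) * (norm (Gamma (u / 2)) * exp (pi * \<bar>y\<bar>))"
      unfolding eq norm_mult by (intro mult_left_mono s) auto
    also have "exp (pi * \<bar>y\<bar>) = exp (pi * \<bar>y\<bar> / 2) * exp (pi * \<bar>y\<bar> / 2)"
      by (simp flip: exp_add)
    also have "norm (Gamma ((1 + u) / 2)) * (norm (Gamma (u / 2)) * (exp (pi * \<bar>y\<bar> / 2) * exp (pi * \<bar>y\<bar> / 2))) =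
       (norm (Gamma ((1 + u) / 2)) * exp (pi * \<bar>y\<bar> / 2)) * (norm (Gamma (u / 2)) * exp (pi * \<bar>y\<bar> / 2))"
      by (simp add: mult_ac)
    also have "\<dots> \<le> (C * (1 + \<bar>y\<bar>) ^ (m + 1)) * (C * (1 + \<bar>y\<bar>) ^ (m + 1))"
      unfolding c1 c2 using u C(1) by (intro mult_mono C(2)) auto
    also have "\<dots> = C\<^sup>2 * (1 + \<bar>y\<bar>) ^ (2 * m + 2)"
      by (simp add: power2_eq_square mult_ac flip: power_add) (simp add: algebra_simps mult_2_right)
    also have "\<dots> \<le> C\<^sup>2 * (2 * norm u) ^ (2 * m + 2)"
    proof (intro mult_left_mono power_mono)
      have "1 \<le> norm u" using u complex_Re_le_cmod[of u] by linarith
      moreover have "\<bar>y\<bar> \<le> norm u" using abs_Im_le_cmod[of u] by (simp add: y_def)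
      ultimately show "1 + \<bar>y\<bar> \<le> 2 * norm u" by linarith
    qed auto
    finally show ?thesis by (simp only: power_mult_distrib mult_ac)
  qed
  then show ?thesis
    by (intro exI[of _ "C\<^sup>2 * 2 ^ (2 * m + 2)"]) auto
qed

section \<open>Parameter-dependent integrals\<close>

text \<open>
  A primitive \<open>P\<close> of \<open>g\<close> gives \<open>P(b + i \<tau>) - P(a + i \<tau>) \<rightarrow> 0\<close> as \<open>\<tau> \<rightarrow> \<plusminus>\<infinity>\<close>; its derivative in \<open>\<tau>\<close> is the
  difference of the two integrands.
\<close>

lemma vertical_line_integral_shift:
  fixes g :: "complex \<Rightarrow> complex"
  assumes ab: "0 < a" "a \<le> b"
    and hol: "g holomorphic_on {u. Re u > 0}"
    and bound: "\<And>u. a \<le> Re u \<Longrightarrow> Re u \<le> b \<Longrightarrow> norm (g u) * (1 + (Im u)\<^sup>2) \<le> C"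
  shows "(\<integral>\<tau>. g (Complex a \<tau>) \<partial>lborel) = (\<integral>\<tau>. g (Complex b \<tau>) \<partial>lborel)"
    and "integrable lborel (\<lambda>\<tau>. g (Complex a \<tau>))"
proof -
  define S where "S = {u::complex. Re u > 0}"
  have "convex S" "open S" unfolding S_def
    by (auto simp: convex_halfspace_Re_gt open_halfspace_Re_gt)
  then obtain P where P: "\<And>u. u \<in> S \<Longrightarrow> (P has_field_derivative g u) (at u)"
    using holomorphic_convex_primitive'[of S g] hol by (metis S_def at_within_open)
  have gcont: "continuous_on S g"
    using hol unfolding S_def by (rule holomorphic_on_imp_continuous_on)
  have lcont: "continuous_on UNIV (\<lambda>\<tau>. g (Complex \<sigma> \<tau>))" if "\<sigma> > 0" for \<sigma>
    using that unfolding Complex_eq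
    by (intro continuous_on_compose2[OF gcont] continuous_intros) (auto simp: S_def)
  have bd: "norm (g u) \<le> C * inverse (1 + (Im u)\<^sup>2)" if "a \<le> Re u" "Re u \<le> b" for u
    using bound[OF that] by (simp add: field_simps add_pos_nonneg)
  have int: "set_integrable lborel UNIV (\<lambda>\<tau>. g (Complex \<sigma> \<tau>))" if "a \<le> \<sigma>" "\<sigma> \<le> b" for \<sigma>
  proof (rule set_integrable_continuous_dominated)
    show "set_integrable lborel UNIV (\<lambda>\<tau>::real. C * inverse (1 + \<tau>\<^sup>2))"
      using integrable_inverse_1_plus_square by simp
    show "continuous_on UNIV (\<lambda>\<tau>. g (Complex \<sigma> \<tau>))"
      using that ab by (intro lcont) simp
    show "norm (g (Complex \<sigma> \<tau>)) \<le> C * inverse (1 + \<tau>\<^sup>2)" for \<tau>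
      using that bd[of "Complex \<sigma> \<tau>"] by simp
  qed simp
  from int[of a] ab show "integrable lborel (\<lambda>\<tau>. g (Complex a \<tau>))"
    by (simp add: set_integrable_def)
  define p where "p = (\<lambda>\<tau>. P (Complex b \<tau>) - P (Complex a \<tau>))"
  have dP: "((\<lambda>\<tau>. P (Complex \<sigma> \<tau>)) has_vector_derivative \<i> * g (Complex \<sigma> \<tau>)) (at \<tau>)" if "\<sigma> > 0" for \<sigma> \<tau>
  proof -
    have "((\<lambda>\<tau>. Complex \<sigma> \<tau>) has_vector_derivative \<i>) (at \<tau>)"
      unfolding Complex_eq by (auto intro!: derivative_eq_intros)
    from field_vector_diff_chain_at[OF this P[of "Complex \<sigma> \<tau>"]] that show ?thesis
      by (simp add: S_def o_def)
  qed
  have pbound: "norm (p \<tau>) \<le> C * (b - a) * inverse (1 + \<tau>\<^sup>2)" for \<tau>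
  proof -
    have "norm (P (Complex b \<tau>) - P (Complex a \<tau>)) \<le> (C * inverse (1 + \<tau>\<^sup>2)) * norm (Complex b \<tau> - Complex a \<tau>)"
    proof (rule field_differentiable_bound[where S = "closed_segment (Complex a \<tau>) (Complex b \<tau>)"])
      fix u assume u: "u \<in> closed_segment (Complex a \<tau>) (Complex b \<tau>)"
      then obtain v where v: "0 \<le> v" "v \<le> 1" "u = (1 - v) *\<^sub>R Complex a \<tau> + v *\<^sub>R Complex b \<tau>"
        by (auto simp: closed_segment_def)
      have "Re u = a + v * (b - a)" "Im u = \<tau>"
        using v(1,2) unfolding v(3) by (simp_all add: algebra_simps)
      moreover have "v * (b - a) \<ge> 0" "v * (b - a) \<le> 1 * (b - a)"
        using v(1,2) ab by (auto intro: mult_left_le_one_le)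
      ultimately have u: "a \<le> Re u" "Re u \<le> b" "Im u = \<tau>" by auto
      show "(P has_field_derivative g u) (at u within closed_segment (Complex a \<tau>) (Complex b \<tau>))"
        using u ab by (intro has_field_derivative_at_within[OF P]) (simp add: S_def)
      show "norm (g u) \<le> C * inverse (1 + \<tau>\<^sup>2)"
        using bd[of u] u by simp
    qed auto
    also have "Complex b \<tau> - Complex a \<tau> = complex_of_real (b - a)"
      by (simp add: complex_eq_iff)
    finally show ?thesis
      using ab by (simp only: p_def norm_of_real) (simp add: mult_ac)
  qed
  have plim: "(p \<longlongrightarrow> 0) F" if "filterlim (\<lambda>x::real. 1 + x\<^sup>2) at_top F" for F
  proof (rule Lim_null_comparison[OF always_eventually])
    show "\<forall>\<tau>. norm (p \<tau>) \<le> C * (b - a) * inverse (1 + \<tau>\<^sup>2)" using pbound by blast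
    have "((\<lambda>\<tau>. inverse (1 + \<tau>\<^sup>2)) \<longlongrightarrow> 0) F"
      by (rule tendsto_inverse_0_at_top[OF that])
    from tendsto_mult_right_zero[OF this] show "((\<lambda>\<tau>. C * (b - a) * inverse (1 + \<tau>\<^sup>2)) \<longlongrightarrow> 0) F" .
  qed
  have "(LBINT \<tau>=-\<infinity>..\<infinity>. \<i> * g (Complex b \<tau>) - \<i> * g (Complex a \<tau>)) = 0 - 0"
  proof (rule interval_integral_FTC_integrable[where F = p])
    fix \<tau> :: real
    show "(p has_vector_derivative \<i> * g (Complex b \<tau>) - \<i> * g (Complex a \<tau>)) (at \<tau>)"
      unfolding p_def using ab by (intro has_vector_derivative_diff dP) auto
    show "isCont (\<lambda>\<tau>. \<i> * g (Complex b \<tau>) - \<i> * g (Complex a \<tau>)) \<tau>"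
      using lcont[of a] lcont[of b] ab
      by (intro continuous_intros) (auto simp: continuous_on_eq_continuous_at)
  next
    have "filterlim (\<lambda>x::real. 1 + x\<^sup>2) at_top at_bot" "filterlim (\<lambda>x::real. 1 + x\<^sup>2) at_top at_top"
      by real_asymp+
    then show "((p \<circ> real_of_ereal) \<longlongrightarrow> 0) (at_right (-\<infinity>))" "((p \<circ> real_of_ereal) \<longlongrightarrow> 0) (at_left \<infinity>)"
      unfolding ereal_tendsto_simps by (auto intro: plim)
  next
    show "set_integrable lborel (einterval (-\<infinity>) \<infinity>) (\<lambda>\<tau>. \<i> * g (Complex b \<tau>) - \<i> * g (Complex a \<tau>))"
      using int[of a] int[of b] ab by simp
  qed simp
  then have "(\<integral>\<tau>. \<i> * g (Complex b \<tau>) - \<i> * g (Complex a \<tau>) \<partial>lborel) = 0"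
    by (simp add: interval_lebesgue_integral_def set_lebesgue_integral_def)
  also have "(\<integral>\<tau>. \<i> * g (Complex b \<tau>) - \<i> * g (Complex a \<tau>) \<partial>lborel) =
     \<i> * (\<integral>\<tau>. g (Complex b \<tau>) \<partial>lborel) - \<i> * (\<integral>\<tau>. g (Complex a \<tau>) \<partial>lborel)"
    using int[of a] int[of b] ab by (simp add: set_integrable_def)
  finally show "(\<integral>\<tau>. g (Complex a \<tau>) \<partial>lborel) = (\<integral>\<tau>. g (Complex b \<tau>) \<partial>lborel)"
    by simp
qed

lemma set_integrable_inverse_one_plus_square:
  "set_integrable lborel {0<..} (\<lambda>x::real. C / (1 + x\<^sup>2))"
proof -
  have "set_integrable lborel UNIV (\<lambda>x::real. C * inverse (1 + x\<^sup>2))"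
    using integrable_inverse_1_plus_square by simp
  then have "set_integrable lborel {0<..} (\<lambda>x::real. C * inverse (1 + x\<^sup>2))"
    by (rule set_integrable_subset) auto
  then show ?thesis by (simp only: divide_inverse)
qed

lemma power_exp_minus_le:
  assumes "(t::real) \<ge> 0"
  shows "t ^ m * exp (- t) \<le> fact m"
proof -
  have "t ^ m /\<^sub>R fact m \<le> (\<Sum>i. t ^ i /\<^sub>R fact i)"
    using sum_le_suminf[OF summable_exp_generic[of t], of "{m}"] assms by simp
  then have "t ^ m / fact m \<le> exp t"
    by (simp add: exp_def divide_inverse mult.commute)
  then show ?thesis
    by (simp add: exp_minus field_simps)
qed

section \<open>Differentiation under the integral sign\<close>

text \<open>Allows differentiation under an integral by integrating a pointwise second-order Taylor
  remainder, in place of a dominated convergence argument for difference quotients.\<close>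

lemma has_derivative_quadratic_remainder:
  fixes f :: "'a::real_normed_vector \<Rightarrow> 'b::real_normed_vector"
  assumes "bounded_linear f'"
    and rem: "\<And>h. norm h \<le> 1 \<Longrightarrow> norm (f (x + h) - f x - f' h) \<le> K * (norm h)\<^sup>2"
  shows "(f has_derivative f') (at x)"
proof (rule has_derivativeI_sandwich[where e = 1 and H = "\<lambda>y. K * norm (y - x)"])
  fix y assume y: "y \<in> UNIV" "y \<noteq> x" "dist y x < 1"
  have "norm (f y - f x - f' (y - x)) \<le> K * norm (y - x) * norm (y - x)"
    using rem[of "y - x"] y by (simp add: dist_norm power2_eq_square mult.assoc)
  then show "norm (f y - f x - f' (y - x)) / norm (y - x) \<le> K * norm (y - x)"
    using y by (simp add: pos_divide_le_eq)
next
  have "((\<lambda>y. K * norm (y - x)) \<longlongrightarrow> K * norm (x - x)) (at x)"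
    by (intro tendsto_intros)
  then show "((\<lambda>y. K * norm (y - x)) \<longlongrightarrow> 0) (at x)" by simp
qed (use assms in auto)

text \<open>Finite exponential moments of |g| of every order make the transform entire: each power
  of \<open>g x\<close> brought down by differentiation or by the Taylor remainder is absorbed into
  a slightly larger exponential.\<close>

lemma exp_transform_holomorphic:
  fixes f :: "'a \<Rightarrow> complex" and g :: "'a \<Rightarrow> real"
  assumes [measurable]: "f \<in> borel_measurable M" "g \<in> borel_measurable M"
    and int: "\<And>n::nat. integrable M (\<lambda>x. norm (f x) * exp (real n * \<bar>g x\<bar>))"
  shows "(\<lambda>u. \<integral>x. f x * exp (u * complex_of_real (g x)) \<partial>M) holomorphic_on A"
proof -
  define \<Phi> where "\<Phi> = (\<lambda>u. \<integral>x. f x * exp (u * complex_of_real (g x)) \<partial>M)"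
  define D where "D = (\<lambda>u. \<integral>x. f x * (complex_of_real (g x) * exp (u * complex_of_real (g x))) \<partial>M)"
  have nexp: "norm (exp (u * complex_of_real y)) \<le> exp (real n * \<bar>y\<bar>)" if "norm u \<le> real n" for u y n
  proof -
    have "Re u * y \<le> \<bar>Re u\<bar> * \<bar>y\<bar>" by (metis abs_ge_self abs_mult)
    also have "\<dots> \<le> real n * \<bar>y\<bar>"
      using that abs_Re_le_cmod[of u] by (intro mult_right_mono) auto
    finally show ?thesis by (simp add: norm_exp_eq_Re)
  qed
  have absle: "\<bar>y\<bar> \<le> exp \<bar>y\<bar>" for y :: real
    using exp_ge_add_one_self[of "\<bar>y\<bar>"] by linarith
  have int0: "integrable M (\<lambda>x. f x * exp (u * complex_of_real (g x)))" for u
  proof (rule Bochner_Integration.integrable_bound[OF int[of "nat \<lceil>norm u\<rceil>"]])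
    have "norm (f x * exp (u * complex_of_real (g x))) \<le> norm (f x) * exp (real (nat \<lceil>norm u\<rceil>) * \<bar>g x\<bar>)" for x
      unfolding norm_mult by (intro mult_left_mono nexp real_nat_ceiling_ge norm_ge_zero)
    then show "AE x in M. norm (f x * exp (u * complex_of_real (g x))) \<le>
        norm (norm (f x) * exp (real (nat \<lceil>norm u\<rceil>) * \<bar>g x\<bar>))"
      by (intro AE_I2) (simp add: norm_mult)
  qed measurable
  have int1: "integrable M (\<lambda>x. f x * (complex_of_real (g x) * exp (u * complex_of_real (g x))))" for u
  proof (rule Bochner_Integration.integrable_bound[OF int[of "Suc (nat \<lceil>norm u\<rceil>)"]])
    have "norm (f x * (complex_of_real (g x) * exp (u * complex_of_real (g x)))) \<le>
        norm (f x) * exp (real (Suc (nat \<lceil>norm u\<rceil>)) * \<bar>g x\<bar>)" for x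
    proof -
      have "norm (complex_of_real (g x) * exp (u * complex_of_real (g x))) \<le>
          exp \<bar>g x\<bar> * exp (real (nat \<lceil>norm u\<rceil>) * \<bar>g x\<bar>)"
        unfolding norm_mult norm_of_real
        by (intro mult_mono absle nexp real_nat_ceiling_ge) auto
      also have "\<dots> = exp (real (Suc (nat \<lceil>norm u\<rceil>)) * \<bar>g x\<bar>)"
        by (simp only: of_nat_Suc distrib_right mult_1 exp_add)
      finally show ?thesis unfolding norm_mult[of "f x"] by (intro mult_left_mono) auto
    qed
    then show "AE x in M. norm (f x * (complex_of_real (g x) * exp (u * complex_of_real (g x)))) \<le>
        norm (norm (f x) * exp (real (Suc (nat \<lceil>norm u\<rceil>)) * \<bar>g x\<bar>))"
      by (intro AE_I2) (simp add: norm_mult)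
  qed measurable
  have "(\<Phi> has_field_derivative D u) (at u)" for u
    unfolding has_field_derivative_def
  proof (rule has_derivative_quadratic_remainder)
    show "bounded_linear ((*) (D u))" by (rule bounded_linear_mult_right)
    \<comment> \<open>The remainder of the exponential costs one factor
      \<open>exp \<bar>g x\<bar>\<close> and \<open>\<bar>g x\<bar>\<^sup>2\<close> costs another,
      so a surplus of 2 over the norm of \<open>u\<close> would do. The 2 in \<open>K\<close> comes
      from \<open>g2\<close>.\<close>
    define n where "n = nat \<lceil>norm u\<rceil> + 3"
    define K where "K = 2 * (\<integral>x. norm (f x) * exp (real n * \<bar>g x\<bar>) \<partial>M)"
    fix h :: complex assume h: "norm h \<le> 1"
    have pt: "norm (f x * exp ((u + h) * complex_of_real (g x)) - f x * exp (u * complex_of_real (g x))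
          - h * (f x * (complex_of_real (g x) * exp (u * complex_of_real (g x)))))
        \<le> 2 * (norm h)\<^sup>2 * (norm (f x) * exp (real n * \<bar>g x\<bar>))" for x
    proof -
      define z where "z = h * complex_of_real (g x)"
      have zn: "norm z = norm h * \<bar>g x\<bar>" by (simp add: z_def norm_mult)
      have zle: "norm z \<le> \<bar>g x\<bar>" unfolding zn using h by (intro mult_left_le_one_le) auto
      have T: "norm (exp z - 1 - z) \<le> exp \<bar>g x\<bar> * (norm z)\<^sup>2"
      proof -
        have "norm (exp z - (\<Sum>i\<le>1. z ^ i / fact i)) \<le> exp (norm z) * (norm z ^ Suc 1) / fact 1"
          by (rule Taylor_exp_field)
        also have "\<dots> \<le> exp \<bar>g x\<bar> * (norm z)\<^sup>2"
          using zle by (simp add: power2_eq_square mult_right_mono)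
        finally show ?thesis by (simp add: algebra_simps)
      qed
      have g2: "\<bar>g x\<bar>\<^sup>2 \<le> 2 * exp \<bar>g x\<bar>"
        using power_exp_minus_le[of "\<bar>g x\<bar>" 2] by (simp add: exp_minus field_simps)
      have "f x * exp ((u + h) * complex_of_real (g x)) - f x * exp (u * complex_of_real (g x))
          - h * (f x * (complex_of_real (g x) * exp (u * complex_of_real (g x))))
        = f x * (exp (u * complex_of_real (g x)) * (exp z - 1 - z))"
        by (simp add: z_def ring_distribs exp_add mult_ac)
      also have "norm \<dots> \<le> norm (f x) * (exp (real (nat \<lceil>norm u\<rceil>) * \<bar>g x\<bar>) * (exp \<bar>g x\<bar> * (norm z)\<^sup>2))"
        unfolding norm_mult by (intro mult_left_mono mult_mono T nexp real_nat_ceiling_ge) auto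
      also have "\<dots> = (norm h)\<^sup>2 * (norm (f x) * (exp (real (nat \<lceil>norm u\<rceil>) * \<bar>g x\<bar>) * (exp \<bar>g x\<bar> * \<bar>g x\<bar>\<^sup>2)))"
        unfolding zn power_mult_distrib by (simp only: mult_ac)
      also have "\<dots> \<le> (norm h)\<^sup>2 * (norm (f x) * (exp (real (nat \<lceil>norm u\<rceil>) * \<bar>g x\<bar>) * (exp \<bar>g x\<bar> * (2 * exp \<bar>g x\<bar>))))"
        by (intro mult_left_mono g2) auto
      also have "\<dots> = 2 * (norm h)\<^sup>2 * (norm (f x) * exp (real (nat \<lceil>norm u\<rceil>) * \<bar>g x\<bar> + \<bar>g x\<bar> + \<bar>g x\<bar>))"
        by (simp only: exp_add mult_ac)
      also have "\<dots> \<le> 2 * (norm h)\<^sup>2 * (norm (f x) * exp (real n * \<bar>g x\<bar>))"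
        by (intro mult_left_mono) (auto simp: n_def algebra_simps)
      finally show ?thesis .
    qed
    have "\<Phi> (u + h) - \<Phi> u - D u * h =
        (\<integral>x. (f x * exp ((u + h) * complex_of_real (g x)) - f x * exp (u * complex_of_real (g x))
          - h * (f x * (complex_of_real (g x) * exp (u * complex_of_real (g x))))) \<partial>M)"
      unfolding \<Phi>_def D_def
      by (subst Bochner_Integration.integral_diff Bochner_Integration.integral_diff integral_mult_right_zero,
          (intro Bochner_Integration.integrable_diff integrable_mult_right int0 int1)+)
         (simp add: Bochner_Integration.integral_diff int0 mult.commute)
    also have "norm \<dots> \<le> (\<integral>x. 2 * (norm h)\<^sup>2 * (norm (f x) * exp (real n * \<bar>g x\<bar>)) \<partial>M)"
      by (rule order_trans[OF integral_norm_bound integral_mono])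
         (intro integrable_norm Bochner_Integration.integrable_diff integrable_mult_right int0 int1 int pt)+
    also have "\<dots> = K * (norm h)\<^sup>2" by (simp add: K_def)
    finally show "norm (\<Phi> (u + h) - \<Phi> u - D u * h) \<le> K * (norm h)\<^sup>2" .
  qed
  then show ?thesis
    unfolding holomorphic_on_def \<Phi>_def[symmetric]
    using field_differentiable_at_within field_differentiable_def by blast
qed

text \<open>The second moment dominates the remainder, since |e^(i x) - 1 - i x| \<le> x^2 / 2 for
  real x. It is applied with v = ln t, which turns \<open>t d/dt\<close> into d/dv.\<close>

lemma fourier_transform_has_vector_derivative:
  fixes f :: "real \<Rightarrow> complex"
  assumes int: "integrable lborel f" "integrable lborel (\<lambda>\<tau>. (- \<i> * of_real \<tau>) * f \<tau>)"
      "integrable lborel (\<lambda>\<tau>. (- \<i> * of_real \<tau>)\<^sup>2 * f \<tau>)"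
  shows "((\<lambda>v. \<integral>\<tau>. f \<tau> * exp (- \<i> * of_real \<tau> * of_real v) \<partial>lborel) has_vector_derivative
     (\<integral>\<tau>. (- \<i> * of_real \<tau>) * f \<tau> * exp (- \<i> * of_real \<tau> * of_real v) \<partial>lborel)) (at v)"
  unfolding has_vector_derivative_def
proof (rule has_derivative_quadratic_remainder)
  define e where "e = (\<lambda>(v::real) (\<tau>::real). exp (- \<i> * of_real \<tau> * of_real v))"
  define D where "D = (\<integral>\<tau>. (- \<i> * of_real \<tau>) * f \<tau> * e v \<tau> \<partial>lborel)"
  define K where "K = (\<integral>\<tau>. norm ((- \<i> * of_real \<tau>)\<^sup>2 * f \<tau>) \<partial>lborel)"
  show "bounded_linear (\<lambda>h. h *\<^sub>R (\<integral>\<tau>. (- \<i> * of_real \<tau>) * f \<tau> * exp (- \<i> * of_real \<tau> * of_real v) \<partial>lborel))"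
    by (rule bounded_linear_scaleR_left)
  have ne: "norm (e v \<tau>) = 1" for v \<tau>
    by (simp add: e_def norm_exp_eq_Re)
  have em: "(\<lambda>\<tau>. e v \<tau>) \<in> borel_measurable lborel" for v
    unfolding e_def by measurable
  have ie: "integrable lborel (\<lambda>\<tau>. g \<tau> * e v \<tau>)" if "integrable lborel g" for g v
    by (rule Bochner_Integration.integrable_bound[OF that])
       (use that em in \<open>auto simp: norm_mult ne intro!: borel_measurable_times\<close>)
  fix h :: real
  have pt: "norm (f \<tau> * e (v + h) \<tau> - f \<tau> * e v \<tau> - of_real h * ((- \<i> * of_real \<tau>) * f \<tau> * e v \<tau>)) \<le>
      h\<^sup>2 * norm ((- \<i> * of_real \<tau>)\<^sup>2 * f \<tau>)" for \<tau>
  proof -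
    define x where "x = - (\<tau> * h)"
    have "norm (iexp x - (\<Sum>k\<le>1. (\<i> * of_real x) ^ k / fact k)) \<le> \<bar>x\<bar> ^ Suc 1 / fact (Suc 1)"
      by (rule iexp_approx1)
    then have "norm (iexp x - 1 - \<i> * of_real x) \<le> x\<^sup>2 / 2"
      by (simp add: power2_eq_square algebra_simps)
    then have a: "norm (iexp x - 1 - \<i> * of_real x) \<le> h\<^sup>2 * \<tau>\<^sup>2"
      by (smt (verit) field_sum_of_halves minus_mult_minus mult.commute power2_eq_square power_mult_distrib x_def zero_le_power2)
    have "e (v + h) \<tau> = e v \<tau> * iexp x"
      by (simp add: e_def x_def ring_distribs mult.assoc flip: exp_add)
    then have "f \<tau> * e (v + h) \<tau> - f \<tau> * e v \<tau> - of_real h * ((- \<i> * of_real \<tau>) * f \<tau> * e v \<tau>) =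
       f \<tau> * (e v \<tau> * (iexp x - 1 - \<i> * of_real x))"
      by (simp add: x_def algebra_simps)
    then have "norm (f \<tau> * e (v + h) \<tau> - f \<tau> * e v \<tau> - of_real h * ((- \<i> * of_real \<tau>) * f \<tau> * e v \<tau>)) =
       norm (f \<tau>) * norm (iexp x - 1 - \<i> * of_real x)"
      by (simp only: norm_mult ne mult_1)
    also have "\<dots> \<le> norm (f \<tau>) * (h\<^sup>2 * \<tau>\<^sup>2)"
      by (intro mult_left_mono a) auto
    finally show ?thesis
      by (simp add: norm_mult norm_power mult_ac)
  qed
  have "(\<integral>\<tau>. f \<tau> * e (v + h) \<tau> \<partial>lborel) - (\<integral>\<tau>. f \<tau> * e v \<tau> \<partial>lborel) - h *\<^sub>R D =
      (\<integral>\<tau>. (f \<tau> * e (v + h) \<tau> - f \<tau> * e v \<tau> - of_real h * ((- \<i> * of_real \<tau>) * f \<tau> * e v \<tau>)) \<partial>lborel)"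
    unfolding D_def scaleR_conv_of_real
    by (simp only: Bochner_Integration.integral_diff integral_mult_right_zero
         Bochner_Integration.integrable_diff integrable_mult_right ie[OF int(1)] ie[OF int(2)])
  also have "norm \<dots> \<le> (\<integral>\<tau>. h\<^sup>2 * norm ((- \<i> * of_real \<tau>)\<^sup>2 * f \<tau>) \<partial>lborel)"
    by (rule Bochner_Integration.integral_norm_bound_integral)
       (intro Bochner_Integration.integrable_diff integrable_mult_right integrable_norm ie int pt)+
  also have "\<dots> = K * (norm h)\<^sup>2" by (simp add: K_def)
  finally show "norm ((\<integral>\<tau>. f \<tau> * exp (- \<i> * of_real \<tau> * of_real (v + h)) \<partial>lborel)
      - (\<integral>\<tau>. f \<tau> * exp (- \<i> * of_real \<tau> * of_real v) \<partial>lborel)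
      - h *\<^sub>R (\<integral>\<tau>. (- \<i> * of_real \<tau>) * f \<tau> * exp (- \<i> * of_real \<tau> * of_real v) \<partial>lborel)) \<le> K * (norm h)\<^sup>2"
    unfolding D_def e_def .
qed

section \<open>The cutoff function and its Mellin transform\<close>

text \<open>A factor t of the polynomial is absorbed by raising \<open>B\<close>, hence the
  generalisation over \<open>B\<close>. The constant coefficient leaves t^B e^(-t) times (1/t)^i
  e^(-1/t), bounded by B! i!; the second exponential controls the singularity at 0.\<close>

lemma poly_power_exp_bounded:
  fixes p :: "real poly"
  shows "\<exists>C. \<forall>t>0. \<bar>poly p t / t ^ i * exp (- t - 1 / t)\<bar> * t ^ B \<le> C"
proof (induction p arbitrary: B)
  case 0
  then show ?case by (intro exI[of _ 0]) auto
next
  case (pCons a p)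
  obtain C where C: "\<And>t. t > 0 \<Longrightarrow> \<bar>poly p t / t ^ i * exp (- t - 1 / t)\<bar> * t ^ Suc B \<le> C"
    using pCons.IH[of "Suc B"] by blast
  have "\<bar>poly (pCons a p) t / t ^ i * exp (- t - 1 / t)\<bar> * t ^ B \<le> \<bar>a\<bar> * (fact B * fact i) + C" if t: "t > 0" for t
  proof -
    have "poly (pCons a p) t / t ^ i * exp (- t - 1 / t) =
        a * (1 / t ^ i * exp (- t - 1 / t)) + t * (poly p t / t ^ i * exp (- t - 1 / t))"
      by (simp add: algebra_simps add_divide_distrib)
    then have "\<bar>poly (pCons a p) t / t ^ i * exp (- t - 1 / t)\<bar> \<le>
        \<bar>a * (1 / t ^ i * exp (- t - 1 / t))\<bar> + \<bar>t * (poly p t / t ^ i * exp (- t - 1 / t))\<bar>"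
      by (simp only: abs_triangle_ineq)
    also have "\<dots> = \<bar>a\<bar> * (1 / t ^ i * exp (- t - 1 / t)) + t * \<bar>poly p t / t ^ i * exp (- t - 1 / t)\<bar>"
      using t by (simp add: abs_mult)
    finally have "\<bar>poly (pCons a p) t / t ^ i * exp (- t - 1 / t)\<bar> * t ^ B \<le>
       (\<bar>a\<bar> * (1 / t ^ i * exp (- t - 1 / t)) + t * \<bar>poly p t / t ^ i * exp (- t - 1 / t)\<bar>) * t ^ B"
      using t by (intro mult_right_mono) auto
    also have "\<dots> = \<bar>a\<bar> * ((t ^ B * exp (- t)) * ((1 / t) ^ i * exp (- (1 / t)))) +
         \<bar>poly p t / t ^ i * exp (- t - 1 / t)\<bar> * t ^ Suc B"
      by (simp add: algebra_simps exp_diff exp_minus divide_inverse power_inverse)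
    also have "\<dots> \<le> \<bar>a\<bar> * (fact B * fact i) + C"
      using t by (intro add_mono mult_left_mono mult_mono power_exp_minus_le C) auto
    finally show ?thesis .
  qed
  then show ?case by blast
qed

text \<open>The recursion is \<open>(t d/dt) (p t\<^sup>-\<^sup>j e\<^sup>-\<^sup>t\<^sup>-\<^sup>1\<^sup>/\<^sup>t) = (t\<^sup>2 p' - j t p - t\<^sup>2 p + p) t\<^sup>-\<^sup>j\<^sup>-\<^sup>1 e\<^sup>-\<^sup>t\<^sup>-\<^sup>1\<^sup>/\<^sup>t\<close>.\<close>

primrec euler_poly :: "nat \<Rightarrow> real poly" where
  "euler_poly 0 = 1"
| "euler_poly (Suc j) = [:0, 0, 1:] * pderiv (euler_poly j) - [:0, real j:] * euler_poly j
     - [:0, 0, 1:] * euler_poly j + euler_poly j"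

definition bump_seq :: "nat \<Rightarrow> real \<Rightarrow> real" where
  "bump_seq j t = poly (euler_poly j) t / t ^ j * exp (- t - 1 / t)"

lemma bump_seq_deriv:
  assumes t: "t > 0"
  shows "(bump_seq j has_real_derivative bump_seq (Suc j) t / t) (at t)"
proof -
  let ?p = "poly (euler_poly j) t" and ?p' = "poly (pderiv (euler_poly j)) t" and ?E = "exp (- t - 1 / t)"
  have "((\<lambda>t. poly (euler_poly j) t / t ^ j) has_real_derivative ?p' / t ^ j - real j * ?p / t ^ Suc j) (at t)"
  proof -
    have "?p' / t ^ j - real j * ?p / t ^ Suc j = (?p' * t ^ j - ?p * (real j * t ^ (j - Suc 0))) / (t ^ j * t ^ j)"
      using t by (cases j) (simp_all add: field_simps)
    then show ?thesis using t
      by (auto intro!: derivative_eq_intros)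
  qed
  moreover have "((\<lambda>t. exp (- t - 1 / t)) has_real_derivative (1 / t\<^sup>2 - 1) * ?E) (at t)"
    using t by (auto intro!: derivative_eq_intros simp: power2_eq_square)
  ultimately have "((\<lambda>t. poly (euler_poly j) t / t ^ j * exp (- t - 1 / t)) has_real_derivative
      (?p' / t ^ j - real j * ?p / t ^ Suc j) * ?E + (1 / t\<^sup>2 - 1) * ?E * (?p / t ^ j)) (at t)"
    by (rule DERIV_mult)
  moreover have "(?p' / t ^ j - real j * ?p / t ^ Suc j) * ?E + (1 / t\<^sup>2 - 1) * ?E * (?p / t ^ j) = bump_seq (Suc j) t / t"
    using t by (simp add: bump_seq_def divide_simps) (simp add: algebra_simps power2_eq_square)
  ultimately show ?thesis
    unfolding bump_seq_def[abs_def] by simp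
qed

lemma bump_seq_bounded: "\<exists>C. \<forall>t>0. \<bar>bump_seq j t\<bar> * t ^ B \<le> C"
  unfolding bump_seq_def by (rule poly_power_exp_bounded)

lemma bump_seq_0: "bump_seq 0 t = exp (- t - 1 / t)"
  by (simp add: bump_seq_def)

lemma continuous_on_bump_seq: "continuous_on {0<..} (bump_seq j)"
  by (intro continuous_at_imp_continuous_on ballI DERIV_isCont[OF bump_seq_deriv]) simp

text \<open>From index 1 on no integral is left: differentiation at the lower limit gives the minus
  sign, and the t of \<open>t d/dt\<close> cancels the 1/y in the integrand of F.\<close>

definition F_seq :: "nat \<Rightarrow> real \<Rightarrow> real" where
  "F_seq j t = (case j of 0 \<Rightarrow> F_cut t | Suc i \<Rightarrow> - (1 / (2 * bessel_K0 2)) * bump_seq i t)"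

lemma F_seq_0: "F_seq 0 t = F_cut t" and F_seq_Suc: "F_seq (Suc i) t = - (1 / (2 * bessel_K0 2)) * bump_seq i t"
  by (simp_all add: F_seq_def)

lemma set_integrable_bump_power:
  "set_integrable lborel {0<..} (\<lambda>y. bump_seq 0 y / y * y ^ B)"
proof -
  obtain C where C: "\<And>t::real. t > 0 \<Longrightarrow> \<bar>poly 1 t / t ^ 1 * exp (- t - 1 / t)\<bar> * t ^ B \<le> C"
    using poly_power_exp_bounded[of 1 1 B] by blast
  \<comment> \<open>The orders B and B + 2 together bound the integrand times 1 + y^2, giving the
    integrable majorant 1 / (1 + y^2) up to a constant. The same device is used for the Mellin
    integrals.\<close>
  obtain D where D: "\<And>t::real. t > 0 \<Longrightarrow> \<bar>poly 1 t / t ^ 1 * exp (- t - 1 / t)\<bar> * t ^ (B + 2) \<le> D"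
    using poly_power_exp_bounded[of 1 1 "B + 2"] by blast
  have bd: "bump_seq 0 y / y * y ^ B \<le> (C + D) / (1 + y\<^sup>2)" if y: "y > 0" for y
  proof -
    have "bump_seq 0 y / y * y ^ B * (1 + y\<^sup>2) \<le> C + D"
    proof -
      have "bump_seq 0 y / y * y ^ B * (1 + y\<^sup>2) =
          \<bar>poly 1 y / y ^ 1 * exp (- y - 1 / y)\<bar> * y ^ B + \<bar>poly 1 y / y ^ 1 * exp (- y - 1 / y)\<bar> * y ^ (B + 2)"
        using y by (simp only: bump_seq_0 power_add distrib_left) simp
      then show ?thesis using C[OF y] D[OF y] by linarith
    qed
    moreover have "1 + y\<^sup>2 > 0" by (simp add: add_pos_nonneg)
    ultimately show ?thesis by (simp only: pos_le_divide_eq)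
  qed
  show "set_integrable lborel {0<..} (\<lambda>y. bump_seq 0 y / y * y ^ B)"
  proof (rule set_integrable_continuous_dominated)
    show "continuous_on {0<..} (\<lambda>y. bump_seq 0 y / y * y ^ B)"
      by (intro continuous_intros continuous_on_bump_seq) auto
    show "set_integrable lborel {0<..} (\<lambda>x::real. (C + D) / (1 + x\<^sup>2))"
      by (rule set_integrable_inverse_one_plus_square)
    show "norm (bump_seq 0 y / y * y ^ B) \<le> (C + D) / (1 + y\<^sup>2)" if "y \<in> {0<..}" for y
      using bd[of y] that by (simp add: bump_seq_0)
  qed simp
qed

lemma F_cut_eq:
  "F_cut x = 1 / (2 * bessel_K0 2) * (LBINT y:{x<..}. bump_seq 0 y / y)"
proof -
  have "einterval (ereal x) \<infinity> = {x<..}" by (auto simp: einterval_def)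
  then show ?thesis
    by (simp add: F_cut_def interval_lebesgue_integral_def bump_seq_0)
qed

lemma F_cut_deriv:
  assumes x: "x > 0"
  shows "(F_cut has_real_derivative F_seq (Suc 0) x / x) (at x)"
proof -
  define h where "h = (\<lambda>y. bump_seq 0 y / y)"
  have int: "set_integrable lborel {0<..} h"
    using set_integrable_bump_power[of 0] by (simp add: h_def)
  have hc: "continuous_on {0<..} h"
    unfolding h_def by (intro continuous_intros continuous_on_bump_seq) auto
  \<comment> \<open>The fundamental theorem needs a fixed finite lower limit; x/2 lies below a
    neighbourhood of x and keeps away from 0, where the formula for the integrand breaks
    down.\<close>
  have split: "(LBINT y:{z<..}. h y) = (LBINT y:{x / 2<..}. h y) - (LBINT y=x/2..z. h y)" if "z \<in> {x / 2<..}" for z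
  proof -
    have "(LBINT y:{x / 2<..}. h y) = (LBINT y:{x / 2<..z} \<union> {z<..}. h y)"
      using that by (intro arg_cong[where f = "\<lambda>A. set_lebesgue_integral lborel A h"]) auto
    also have "\<dots> = (LBINT y:{x / 2<..z}. h y) + (LBINT y:{z<..}. h y)"
      using x that by (intro set_integral_Un set_integrable_subset[OF int]) auto
    finally show ?thesis
      using that by (simp add: interval_integral_Ioc)
  qed
  have "((\<lambda>z. LBINT y=x/2..z. h y) has_vector_derivative h x) (at x within {x / 2..2 * x})"
    using x by (intro interval_integral_FTC2 continuous_on_subset[OF hc]) auto
  then have "((\<lambda>z. LBINT y=x/2..z. h y) has_vector_derivative h x) (at x)"
    using x by (simp add: at_within_Icc_at)
  then have "((\<lambda>z. LBINT y=x/2..z. h y) has_real_derivative h x) (at x)"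
    by (simp add: has_real_derivative_iff_has_vector_derivative)
  then have "((\<lambda>z. (LBINT y:{x / 2<..}. h y) - (LBINT y=x/2..z. h y)) has_real_derivative - h x) (at x)"
    by (auto intro!: derivative_eq_intros)
  then have "((\<lambda>z. LBINT y:{z<..}. h y) has_real_derivative - h x) (at x)"
    by (rule has_field_derivative_transform_within_open[where S = "{x / 2<..}"]) (use x split in auto)
  from DERIV_cmult[OF this, of "1 / (2 * bessel_K0 2)"] show ?thesis
    unfolding F_cut_eq[abs_def] h_def F_seq_Suc by simp
qed

lemma F_seq_deriv:
  assumes "t > 0"
  shows "(F_seq j has_real_derivative F_seq (Suc j) t / t) (at t)"
proof (cases j)
  case 0
  then show ?thesis
    using F_cut_deriv[OF assms] by (simp add: F_seq_0[abs_def])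
next
  case (Suc i)
  from DERIV_cmult[OF bump_seq_deriv[OF assms, of i], of "- (1 / (2 * bessel_K0 2))"] show ?thesis
    unfolding Suc F_seq_Suc[abs_def] by simp
qed

lemma F_seq_bounded: "\<exists>C. \<forall>t>0. \<bar>F_seq j t\<bar> * t ^ B \<le> C"
proof (cases j)
  case (Suc i)
  obtain C where C: "\<And>t. t > 0 \<Longrightarrow> \<bar>bump_seq i t\<bar> * t ^ B \<le> C"
    using bump_seq_bounded by blast
  have "\<bar>F_seq j t\<bar> * t ^ B \<le> \<bar>1 / (2 * bessel_K0 2)\<bar> * C" if "t > 0" for t
    using mult_left_mono[OF C[OF that], of "\<bar>1 / (2 * bessel_K0 2)\<bar>"]
    by (simp only: Suc F_seq_Suc abs_mult abs_minus_cancel mult.assoc abs_ge_zero)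
  then show ?thesis by blast
next
  case 0
  \<comment> \<open>On the range y > t the factor t^B may be replaced by y^B under the integral, and
    the range then enlarged to all y > 0.\<close>
  define J where "J = (LBINT y:{0<..}. bump_seq 0 y / y * y ^ B)"
  have "\<bar>F_seq j t\<bar> * t ^ B \<le> \<bar>1 / (2 * bessel_K0 2)\<bar> * J" if t: "t > 0" for t
  proof -
    have int0: "set_integrable lborel {t<..} (\<lambda>y. bump_seq 0 y / y)"
      by (rule set_integrable_subset[of _ "{0<..}"])
        (use t set_integrable_bump_power[of 0] in \<open>simp_all add: greaterThan_subset_iff\<close>)
    have intB: "set_integrable lborel {t<..} (\<lambda>y. bump_seq 0 y / y * y ^ B)"
      by (rule set_integrable_subset[OF set_integrable_bump_power]) (use t in \<open>simp_all add: greaterThan_subset_iff\<close>)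
    have "\<bar>LBINT y:{t<..}. bump_seq 0 y / y\<bar> * t ^ B = (LBINT y:{t<..}. bump_seq 0 y / y) * t ^ B"
      unfolding set_lebesgue_integral_def using t
      by (subst abs_of_nonneg) (auto intro!: integral_nonneg_AE simp: bump_seq_0 indicator_def)
    also have "\<dots> = (LBINT y:{t<..}. bump_seq 0 y / y * t ^ B)"
      by (rule set_integral_mult_left[symmetric])
    also have "\<dots> \<le> (LBINT y:{t<..}. bump_seq 0 y / y * y ^ B)"
      using t by (intro set_integral_mono set_integrable_mult_left int0 intB mult_left_mono power_mono)
        (auto simp: bump_seq_0)
    also have "\<dots> \<le> J"
      unfolding J_def set_lebesgue_integral_def
      by (rule integral_mono) (use t intB set_integrable_bump_power[of B] in
          \<open>auto simp: set_integrable_def bump_seq_0 indicator_def\<close>)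
    finally have "\<bar>LBINT y:{t<..}. bump_seq 0 y / y\<bar> * t ^ B \<le> J" .
    from mult_left_mono[OF this, of "\<bar>1 / (2 * bessel_K0 2)\<bar>"] show ?thesis
      by (simp only: 0 F_seq_0 F_cut_eq abs_mult mult.assoc abs_ge_zero)
  qed
  then show ?thesis by blast
qed

lemma F_seq_powr_bound:
  "\<exists>C\<ge>0. \<forall>\<sigma> x. 1 \<le> \<sigma> \<longrightarrow> \<sigma> \<le> real m \<longrightarrow> x > 0 \<longrightarrow> \<bar>F_seq j x\<bar> * x powr (\<sigma> - 1) \<le> C / (1 + x\<^sup>2)"
proof -
  have "\<forall>B. \<exists>C. \<forall>t>0. \<bar>F_seq j t\<bar> * t ^ B \<le> C" by (simp add: F_seq_bounded)
  then obtain c where c: "\<And>B t. t > 0 \<Longrightarrow> \<bar>F_seq j t\<bar> * t ^ B \<le> c B" by metis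
  \<comment> \<open>For 1 \<le> \<sigma> \<le> m the power x^(\<sigma> - 1) is at most 1 + x^m. The
    four constants belong to the terms of (1 + x^m)(1 + x^2), so the bound is uniform in
    \<sigma>.\<close>
  define C where "C = c 0 + c 2 + c m + c (m + 2)"
  have "0 \<le> c B" for B
    by (rule order_trans[OF _ c[of 1 B]]) auto
  then have C0: "C \<ge> 0" by (simp add: C_def)
  have "\<bar>F_seq j x\<bar> * x powr (\<sigma> - 1) \<le> C / (1 + x\<^sup>2)" if s: "1 \<le> \<sigma>" "\<sigma> \<le> real m" and x: "x > 0" for \<sigma> x
  proof -
    have "x powr (\<sigma> - 1) \<le> 1 + x ^ m"
    proof (cases "x \<le> 1")
      case True
      then have "x powr (\<sigma> - 1) \<le> 1" using s x by (intro powr_le1) auto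
      moreover have "0 \<le> x ^ m" using x by simp
      ultimately show ?thesis by linarith
    next
      case False
      then have "x powr (\<sigma> - 1) \<le> x powr real m" using s by (intro powr_mono) auto
      also have "\<dots> = x ^ m" using x by (simp add: powr_realpow)
      finally show ?thesis by simp
    qed
    then have "\<bar>F_seq j x\<bar> * x powr (\<sigma> - 1) * (1 + x\<^sup>2) \<le> \<bar>F_seq j x\<bar> * (1 + x ^ m) * (1 + x\<^sup>2)"
      by (intro mult_right_mono mult_left_mono) auto
    also have "\<dots> = \<bar>F_seq j x\<bar> * x ^ 0 + \<bar>F_seq j x\<bar> * x\<^sup>2 + \<bar>F_seq j x\<bar> * x ^ m + \<bar>F_seq j x\<bar> * x ^ (m + 2)"
      unfolding power_add by (simp add: algebra_simps)
    also have "\<dots> \<le> C"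
      unfolding C_def by (intro add_mono c x)
    finally have "\<bar>F_seq j x\<bar> * x powr (\<sigma> - 1) * (1 + x\<^sup>2) \<le> C" .
    moreover have "1 + x\<^sup>2 > 0" by (simp add: add_pos_nonneg)
    ultimately show ?thesis by (simp only: pos_le_divide_eq)
  qed
  with C0 show ?thesis by blast
qed

section \<open>Mellin transforms of F and its Euler derivatives\<close>

text \<open>The power x^(u - 1) is written as an exponential of ln x so that norms, derivatives and
  \<open>exp_transform_holomorphic\<close> apply directly.\<close>

definition F_mellin :: "nat \<Rightarrow> complex \<Rightarrow> complex" where
  "F_mellin j u = (LBINT x:{0<..}. complex_of_real (F_seq j x) * exp ((u - 1) * complex_of_real (ln x)))"

lemma norm_F_mellin_integrand:
  assumes "x > 0"
  shows "norm (complex_of_real (F_seq j x) * exp ((u - 1) * complex_of_real (ln x))) = \<bar>F_seq j x\<bar> * x powr (Re u - 1)"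
  using assms by (simp add: norm_mult norm_exp_eq_Re powr_def)

lemma continuous_on_F_mellin_integrand:
  "continuous_on {0<..} (\<lambda>x. complex_of_real (F_seq j x) * exp ((u - 1) * complex_of_real (ln x)))"
proof -
  have "continuous_on {0<..} (F_seq j)"
    by (intro continuous_at_imp_continuous_on ballI DERIV_isCont[OF F_seq_deriv]) simp
  then show ?thesis by (intro continuous_intros) auto
qed

lemma set_integrable_F_mellin:
  assumes "1 \<le> Re u"
  shows "set_integrable lborel {0<..} (\<lambda>x. complex_of_real (F_seq j x) * exp ((u - 1) * complex_of_real (ln x)))"
proof -
  have m: "Re u \<le> real (nat \<lceil>Re u\<rceil>)" by (rule real_nat_ceiling_ge)
  obtain C where C: "\<And>x. x > 0 \<Longrightarrow> \<bar>F_seq j x\<bar> * x powr (Re u - 1) \<le> C / (1 + x\<^sup>2)"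
    using F_seq_powr_bound[of "nat \<lceil>Re u\<rceil>" j] assms m by blast
  show ?thesis
  proof (rule set_integrable_continuous_dominated)
    show "norm (complex_of_real (F_seq j x) * exp ((u - 1) * complex_of_real (ln x))) \<le> C / (1 + x\<^sup>2)"
      if "x \<in> {0<..}" for x
      using C[of x] that by (simp only: greaterThan_iff norm_F_mellin_integrand)
  qed (simp_all add: continuous_on_F_mellin_integrand set_integrable_inverse_one_plus_square)
qed

lemma norm_F_mellin_le:
  "\<exists>C\<ge>0. \<forall>u. 1 \<le> Re u \<longrightarrow> Re u \<le> real m \<longrightarrow> norm (F_mellin j u) \<le> C"
proof -
  obtain C where C: "C \<ge> 0" "\<And>\<sigma> x. 1 \<le> \<sigma> \<Longrightarrow> \<sigma> \<le> real m \<Longrightarrow> x > 0 \<Longrightarrow> \<bar>F_seq j x\<bar> * x powr (\<sigma> - 1) \<le> C / (1 + x\<^sup>2)"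
    using F_seq_powr_bound[of m j] by blast
  define D where "D = (LBINT x:{0<..}. C / (1 + x\<^sup>2))"
  have "norm (F_mellin j u) \<le> D" if "1 \<le> Re u" "Re u \<le> real m" for u
    unfolding F_mellin_def D_def
  proof (rule norm_set_integral_le)
    show "norm (complex_of_real (F_seq j x) * exp ((u - 1) * complex_of_real (ln x))) \<le> C / (1 + x\<^sup>2)"
      if "x \<in> {0<..}" for x
      using C(2)[of "Re u" x] that \<open>1 \<le> Re u\<close> \<open>Re u \<le> real m\<close>
      by (simp only: greaterThan_iff norm_F_mellin_integrand)
  qed (use that in \<open>simp_all add: set_integrable_F_mellin set_integrable_inverse_one_plus_square\<close>)
  then have "\<forall>u. 1 \<le> Re u \<longrightarrow> Re u \<le> real m \<longrightarrow> norm (F_mellin j u) \<le> max D 0"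
    by (auto simp: le_max_iff_disj)
  then show ?thesis by (intro exI[of _ "max D 0"]) auto
qed

text \<open>Integrate the derivative of F_j(x) x^u. That product is O(x / (1 + x^2)), hence vanishes
  at 0 and at infinity. Every application trades a factor u for one more Euler derivative.\<close>

lemma F_mellin_by_parts:
  assumes u: "1 \<le> Re u"
  shows "u * F_mellin j u = - F_mellin (Suc j) u"
proof -
  define E where "E = (\<lambda>x. exp ((u - 1) * complex_of_real (ln x)))"
  define f where "f = (\<lambda>x. complex_of_real (F_seq (Suc j) x) * E x + u * (complex_of_real (F_seq j x) * E x))"
  define P where "P = (\<lambda>x. complex_of_real (F_seq j x) * exp (u * complex_of_real (ln x)))"
  have ei: "einterval 0 \<infinity> = {(0::real)<..}" by (auto simp: einterval_def)
  have int: "set_integrable lborel {0<..} (\<lambda>x. complex_of_real (F_seq j x) * E x)" for j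
    unfolding E_def by (rule set_integrable_F_mellin[OF u])
  have fi: "set_integrable lborel {0<..} f"
    unfolding f_def by (intro set_integral_add set_integrable_mult_right int)
  have fc: "continuous_on {0<..} f"
    unfolding f_def E_def by (intro continuous_on_add continuous_on_mult continuous_on_const continuous_on_F_mellin_integrand)
  have xE: "exp (u * complex_of_real (ln x)) = complex_of_real x * E x" if "x > 0" for x
  proof -
    have "complex_of_real x = exp (complex_of_real (ln x))"
      using that by (simp add: exp_of_real)
    then show ?thesis by (simp add: E_def algebra_simps flip: exp_add)
  qed
  have m: "Re u \<le> real (nat \<lceil>Re u\<rceil>)" by (rule real_nat_ceiling_ge)
  obtain C where C: "\<And>x. x > 0 \<Longrightarrow> \<bar>F_seq j x\<bar> * x powr (Re u - 1) \<le> C / (1 + x\<^sup>2)"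
    using F_seq_powr_bound[of "nat \<lceil>Re u\<rceil>" j] u m by blast
  have Pb: "norm (P x) \<le> C * (x / (1 + x\<^sup>2))" if "x > 0" for x
  proof -
    have "norm (P x) = x * norm (complex_of_real (F_seq j x) * E x)"
      using that by (simp add: P_def xE norm_mult)
    also have "\<dots> \<le> x * (C / (1 + x\<^sup>2))"
      using C[OF that] that unfolding E_def by (intro mult_left_mono) (simp_all only: norm_F_mellin_integrand less_imp_le)
    finally show ?thesis by (simp add: mult.commute)
  qed
  have lim: "(P \<longlongrightarrow> 0) F" if "eventually (\<lambda>x. x > 0) F" "((\<lambda>x::real. x / (1 + x\<^sup>2)) \<longlongrightarrow> 0) F" for F
  proof (rule Lim_null_comparison)
    show "eventually (\<lambda>x. norm (P x) \<le> C * (x / (1 + x\<^sup>2))) F"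
      using that(1) by eventually_elim (rule Pb)
    show "((\<lambda>x. C * (x / (1 + x\<^sup>2))) \<longlongrightarrow> 0) F"
      by (rule tendsto_mult_right_zero[OF that(2)])
  qed
  have "(LBINT x=0..\<infinity>. f x) = 0 - 0"
  proof (rule interval_integral_FTC_integrable[where F = P])
    fix x :: real assume "0 < ereal x"
    then have x: "x > 0" by simp
    have 1: "((\<lambda>x. complex_of_real (F_seq j x)) has_vector_derivative complex_of_real (F_seq (Suc j) x / x)) (at x)"
      by (rule has_vector_derivative_of_real[OF F_seq_deriv[OF x]])
    have "((\<lambda>x. u * complex_of_real (ln x)) has_vector_derivative u * complex_of_real (1 / x)) (at x)"
      using x by (intro has_vector_derivative_mult_right has_vector_derivative_of_real DERIV_ln_divide)
    from field_vector_diff_chain_at[OF this DERIV_exp]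
    have 2: "((\<lambda>x. exp (u * complex_of_real (ln x))) has_vector_derivative
        (u * complex_of_real (1 / x)) * exp (u * complex_of_real (ln x))) (at x)"
      by (simp add: o_def)
    have "(P has_vector_derivative complex_of_real (F_seq j x) * ((u * complex_of_real (1 / x)) * exp (u * complex_of_real (ln x)))
       + complex_of_real (F_seq (Suc j) x / x) * exp (u * complex_of_real (ln x))) (at x)"
      unfolding P_def by (rule has_vector_derivative_mult[OF 1 2])
    also have "complex_of_real (F_seq j x) * ((u * complex_of_real (1 / x)) * exp (u * complex_of_real (ln x)))
       + complex_of_real (F_seq (Suc j) x / x) * exp (u * complex_of_real (ln x)) = f x"
      using x unfolding xE[OF x] f_def by simp
    finally show "(P has_vector_derivative f x) (at x)" .
    show "isCont f x" using fc x by (simp add: continuous_on_eq_continuous_at)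
  next
    have "((\<lambda>x::real. x / (1 + x\<^sup>2)) \<longlongrightarrow> 0) (at_right 0)" "((\<lambda>x::real. x / (1 + x\<^sup>2)) \<longlongrightarrow> 0) at_top"
      by real_asymp+
    then show "((P \<circ> real_of_ereal) \<longlongrightarrow> 0) (at_right 0)" "((P \<circ> real_of_ereal) \<longlongrightarrow> 0) (at_left \<infinity>)"
      unfolding zero_ereal_def ereal_tendsto_simps
      by (auto intro!: lim eventually_gt_at_top eventually_at_right_less)
  next
    show "set_integrable lborel (einterval 0 \<infinity>) f" unfolding ei by (rule fi)
  qed simp
  then have "(LBINT x:{0<..}. f x) = 0"
    by (simp add: interval_lebesgue_integral_def ei)
  also have "(LBINT x:{0<..}. f x) = F_mellin (Suc j) u + u * F_mellin j u"
    unfolding f_def F_mellin_def E_def[THEN fun_cong, symmetric]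
    by (simp add: set_integral_add int)
  finally show ?thesis by (rule minus_unique[symmetric])
qed

text \<open>Together with \<open>norm_F_mellin_le\<close> this is the decay of the Mellin transform
  of F faster than any power of |u|, uniformly in strips.\<close>

lemma power_mult_F_mellin:
  assumes "1 \<le> Re u"
  shows "norm u ^ m * norm (F_mellin 0 u) = norm (F_mellin m u)"
proof (induction m)
  case (Suc m)
  have "norm u ^ Suc m * norm (F_mellin 0 u) = norm (u * F_mellin m u)"
    by (simp add: norm_mult Suc.IH[symmetric])
  then show ?case by (simp add: F_mellin_by_parts[OF assms])
qed simp

lemma mellin_F_cut: "mellin (\<lambda>x. complex_of_real (F_cut x)) u = F_mellin 0 u"
proof -
  have ei: "einterval 0 \<infinity> = {(0::real)<..}" by (auto simp: einterval_def)
  have "mellin (\<lambda>x. complex_of_real (F_cut x)) u = (LBINT x:{0<..}. complex_of_real (F_cut x) * complex_of_real x powr (u - 1))"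
    by (simp add: mellin_def interval_lebesgue_integral_def ei)
  also have "\<dots> = F_mellin 0 u"
    unfolding F_mellin_def F_seq_0
    by (rule set_lebesgue_integral_cong) (auto simp: powr_def Ln_of_real)
  finally show ?thesis .
qed

text \<open>The exponential moments of |ln x| require control of both x^n and x^(-n). A multiple of
  e^(-x - 1/x), being flat at 0, provides it; F itself does not vanish at 0.\<close>

lemma F_mellin_1_holomorphic: "F_mellin (Suc 0) holomorphic_on A"
proof -
  define k where "k = - (1 / (2 * bessel_K0 2))"
  \<comment> \<open>Moving 1/x into \<open>f\<close> removes the -1 from the exponent u - 1.\<close>
  define f where "f = (\<lambda>x. indicator {0<..} x *\<^sub>R complex_of_real (F_seq (Suc 0) x / x))"
  have c: "continuous_on {0<..} (\<lambda>x. F_seq (Suc 0) x / x)"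
    unfolding F_seq_Suc by (intro continuous_intros continuous_on_bump_seq) auto
  have fm: "f \<in> borel_measurable lborel"
    unfolding f_def using borel_measurable_continuous_on_indicator[OF _ continuous_on_of_real[OF c, where 'a = complex]]
    by (simp del: of_real_divide)
  have gm: "ln \<in> borel_measurable (lborel :: real measure)" by measurable
  have "integrable lborel (\<lambda>x. norm (f x) * exp (real n * \<bar>ln x\<bar>))" for n
  proof -
    have "\<forall>i B. \<exists>C. \<forall>t>0. \<bar>poly 1 t / t ^ i * exp (- t - 1 / t)\<bar> * t ^ B \<le> (C::real)"
      by (intro allI poly_power_exp_bounded)
    then obtain c where c: "\<And>i B t. t > 0 \<Longrightarrow> \<bar>poly 1 t / t ^ i * exp (- t - 1 / t)\<bar> * t ^ B \<le> (c i B::real)"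
      by metis
    \<comment> \<open>One constant for each term of (x^n + x^(-n)) (1 + x^2), the denominators
      including the 1/x of \<open>f\<close>.\<close>
    define C where "C = c 1 n + c 1 (n + 2) + c (Suc n) 0 + c (Suc n) 2"
    have bd: "\<bar>F_seq (Suc 0) x / x\<bar> * exp (real n * \<bar>ln x\<bar>) \<le> \<bar>k\<bar> * C / (1 + x\<^sup>2)" if x: "x > 0" for x
    proof -
      have e: "exp (real n * \<bar>ln x\<bar>) \<le> x ^ n + 1 / x ^ n"
      proof (cases "x \<ge> 1")
        case True
        then have "exp (real n * \<bar>ln x\<bar>) = x ^ n"
          using x by (simp add: exp_of_nat_mult)
        then show ?thesis using x by simp
      next
        case False
        then have "exp (real n * \<bar>ln x\<bar>) = 1 / x ^ n"
          using x by (simp add: exp_minus exp_of_nat_mult inverse_eq_divide power_divide)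
        then show ?thesis using x by simp
      qed
      define E where "E = exp (- x - 1 / x)"
      have "E / x * exp (real n * \<bar>ln x\<bar>) * (1 + x\<^sup>2) \<le> E / x * (x ^ n + 1 / x ^ n) * (1 + x\<^sup>2)"
        using x by (intro mult_right_mono mult_left_mono e) (auto simp: E_def)
      also have "\<dots> = \<bar>poly 1 x / x ^ 1 * E\<bar> * x ^ n + \<bar>poly 1 x / x ^ 1 * E\<bar> * x ^ (n + 2)
         + \<bar>poly 1 x / x ^ Suc n * E\<bar> * x ^ 0 + \<bar>poly 1 x / x ^ Suc n * E\<bar> * x ^ 2"
        using x by (simp add: E_def power_add) (simp add: field_simps power2_eq_square)
      also have "\<dots> \<le> C"
        unfolding C_def E_def by (intro add_mono c x)
      finally have "\<bar>k\<bar> * (E / x * exp (real n * \<bar>ln x\<bar>) * (1 + x\<^sup>2)) \<le> \<bar>k\<bar> * C"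
        by (rule mult_left_mono) simp
      moreover have "1 + x\<^sup>2 > 0" by (simp add: add_pos_nonneg)
      moreover have "\<bar>F_seq (Suc 0) x / x\<bar> = \<bar>k\<bar> * (E / x)"
        using x by (simp add: F_seq_Suc bump_seq_0 E_def k_def abs_mult)
      ultimately show ?thesis
        by (simp only: pos_le_divide_eq mult.assoc)
    qed
    have "integrable lborel (\<lambda>x. indicator {0<..} x *\<^sub>R (\<bar>k\<bar> * C / (1 + x\<^sup>2)))"
      using set_integrable_inverse_one_plus_square[of "\<bar>k\<bar> * C"] by (simp add: set_integrable_def)
    then show ?thesis
    proof (rule Bochner_Integration.integrable_bound)
      show "(\<lambda>x. norm (f x) * exp (real n * \<bar>ln x\<bar>)) \<in> borel_measurable lborel"
        using fm gm by measurable
      show "AE x in lborel. norm (norm (f x) * exp (real n * \<bar>ln x\<bar>)) \<le> norm (indicat_real {0<..} x *\<^sub>R (\<bar>k\<bar> * C / (1 + x\<^sup>2)))"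
      proof (rule AE_I2)
        fix x :: real
        show "norm (norm (f x) * exp (real n * \<bar>ln x\<bar>)) \<le> norm (indicat_real {0<..} x *\<^sub>R (\<bar>k\<bar> * C / (1 + x\<^sup>2)))"
          using order_trans[OF bd[of x] abs_ge_self]
          by (cases "x > 0") (simp_all add: f_def del: abs_divide of_real_divide)
      qed
    qed
  qed
  from exp_transform_holomorphic[OF fm gm this]
  have hol: "(\<lambda>u. \<integral>x. f x * exp (u * complex_of_real (ln x)) \<partial>lborel) holomorphic_on A" .
  have "F_mellin (Suc 0) u = (\<integral>x. f x * exp (u * complex_of_real (ln x)) \<partial>lborel)" for u
    unfolding F_mellin_def set_lebesgue_integral_def
  proof (rule Bochner_Integration.integral_cong[OF refl])
    fix x :: real
    have "exp ((u - 1) * complex_of_real (ln x)) = exp (u * complex_of_real (ln x)) / complex_of_real x" if "x > 0"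
      using that by (simp add: left_diff_distrib exp_diff exp_of_real)
    then show "indicat_real {0<..} x *\<^sub>R (complex_of_real (F_seq (Suc 0) x) * exp ((u - 1) * complex_of_real (ln x))) =
        f x * exp (u * complex_of_real (ln x))"
      by (cases "x > 0") (simp_all add: f_def)
  qed
  then have "F_mellin (Suc 0) = (\<lambda>u. \<integral>x. f x * exp (u * complex_of_real (ln x)) \<partial>lborel)" by blast
  with hol show ?thesis by simp
qed

section \<open>The dual cutoff function\<close>

text \<open>
  Writing the Mellin transform of \<open>F\<close> as \<open>- F_mellin 1 u / u\<close> makes its holomorphy evident: \<open>F_seq 1\<close>
  decays at \<open>0\<close> and at \<open>\<infinity>\<close>, so \<open>F_mellin 1\<close> is entire.
\<close>

definition H_kernel :: "complex \<Rightarrow> complex" where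
  "H_kernel u = gamma_ratio u * exp (- u * complex_of_real (ln pi)) * (- (F_mellin (Suc 0) u / u))"

lemma H_kernel_holomorphic: "H_kernel holomorphic_on {u. Re u > 0}"
  unfolding H_kernel_def[abs_def]
  by (intro holomorphic_intros gamma_ratio_holomorphic F_mellin_1_holomorphic) auto

lemma H_kernel_eq:
  assumes "1 \<le> Re u"
  shows "H_kernel u = gamma_ratio u * exp (- u * complex_of_real (ln pi)) * F_mellin 0 u"
proof -
  have "u \<noteq> 0" using assms by auto
  then have "F_mellin 0 u = - (F_mellin (Suc 0) u / u)"
    using F_mellin_by_parts[OF assms, of 0] by (simp add: field_simps)
  then show ?thesis by (simp add: H_kernel_def)
qed

text \<open>A count of powers of |u|: j from (1 - u)^j, 2 m + 2 from the Gamma quotient and 2 from 1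
  + (Im u)^2. That many integrations by parts in the Mellin integral absorb them all, and
  |\<pi>^(-u)| \<le> 1 on the strip.\<close>

lemma H_kernel_strip_bound:
  "\<exists>C. \<forall>u. 1 \<le> Re u \<longrightarrow> Re u \<le> real m \<longrightarrow> norm ((1 - u) ^ j * H_kernel u) * (1 + (Im u)\<^sup>2) \<le> C"
proof -
  obtain C1 where C1: "C1 \<ge> 0" "\<And>u. 1 \<le> Re u \<Longrightarrow> Re u \<le> real m \<Longrightarrow> norm (gamma_ratio u) \<le> C1 * norm u ^ (2 * m + 2)"
    using norm_gamma_ratio_le[of m] by blast
  obtain C2 where C2: "\<And>u. 1 \<le> Re u \<Longrightarrow> Re u \<le> real m \<Longrightarrow> norm (F_mellin (j + (2 * m + 2) + 2) u) \<le> C2"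
    using norm_F_mellin_le[of m] by blast
  have "norm ((1 - u) ^ j * H_kernel u) * (1 + (Im u)\<^sup>2) \<le> 2 ^ j * C1 * C2" if u: "1 \<le> Re u" "Re u \<le> real m" for u
  proof -
    have n1: "1 \<le> norm u" using u complex_Re_le_cmod[of u] by linarith
    have a: "norm (1 - u) \<le> 2 * norm u"
      using norm_triangle_ineq4[of 1 u] n1 by simp
    have "1 \<le> (Re u)\<^sup>2" using u by simp
    then have b: "1 + (Im u)\<^sup>2 \<le> (norm u)\<^sup>2"
      by (simp add: cmod_power2)
    have c: "norm (exp (- u * complex_of_real (ln pi))) \<le> 1"
      using u pi_gt3 by (simp add: norm_exp_eq_Re)
    have "norm ((1 - u) ^ j * H_kernel u) * (1 + (Im u)\<^sup>2) =
       norm (1 - u) ^ j * (norm (gamma_ratio u) * norm (exp (- u * complex_of_real (ln pi))) * norm (F_mellin 0 u)) * (1 + (Im u)\<^sup>2)"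
      by (simp add: H_kernel_eq[OF u(1)] norm_mult norm_power)
    also have "\<dots> \<le> (2 * norm u) ^ j * ((C1 * norm u ^ (2 * m + 2)) * 1 * norm (F_mellin 0 u)) * (norm u)\<^sup>2"
      using C1(1) by (intro mult_mono power_mono a b c C1(2) u order_refl mult_nonneg_nonneg) auto
    also have "\<dots> = 2 ^ j * C1 * (norm u ^ (j + (2 * m + 2) + 2) * norm (F_mellin 0 u))"
      by (simp only: power_mult_distrib power_add mult_1_right mult_ac)
    also have "\<dots> \<le> 2 ^ j * C1 * C2"
      unfolding power_mult_F_mellin[OF u(1)] using C1(1) by (intro mult_left_mono C2 u) auto
    finally show ?thesis .
  qed
  then show ?thesis by blast
qed

text \<open>The inverse Mellin integral of t H(t) with \<open>t d/dt\<close> applied j times to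
  t^(1-u), each application giving a factor 1 - u. The i of du = i d\<tau> has cancelled the one in
  2 \<pi> i.\<close>

definition H_seq :: "nat \<Rightarrow> real \<Rightarrow> complex" where
  "H_seq j t = complex_of_real (sqrt pi / (2 * pi)) *
     (\<integral>\<tau>. (1 - Complex 1 \<tau>) ^ j * H_kernel (Complex 1 \<tau>) * exp ((1 - Complex 1 \<tau>) * complex_of_real (ln t)) \<partial>lborel)"

lemma H_seq_0:
  assumes t: "t > 0"
  shows "H_seq 0 t = complex_of_real t * H_cut t"
proof -
  have pt: "H_kernel u * exp ((1 - u) * complex_of_real (ln t)) =
     complex_of_real t * (Gamma ((1 + u) / 2) / Gamma ((2 - u) / 2) * complex_of_real (pi * t) powr (- u) *
       mellin (\<lambda>x. complex_of_real (F_cut x)) u)" if "1 \<le> Re u" for u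
  proof -
    have "complex_of_real (pi * t) powr (- u) = exp (- u * complex_of_real (ln (pi * t)))"
      using t by (simp add: powr_def Ln_of_real del: of_real_mult)
    also have "ln (pi * t) = ln pi + ln t" using t by (simp add: ln_mult)
    also have "exp (- u * complex_of_real (ln pi + ln t)) =
        exp (- u * complex_of_real (ln pi)) * exp (- u * complex_of_real (ln t))"
      by (simp add: ring_distribs flip: exp_add)
    finally have 1: "complex_of_real (pi * t) powr (- u) = \<dots>" .
    have "exp ((1 - u) * complex_of_real (ln t)) = exp (complex_of_real (ln t)) * exp (- u * complex_of_real (ln t))"
      by (simp add: algebra_simps flip: exp_add)
    also have "exp (complex_of_real (ln t)) = complex_of_real t"
      using t by (simp add: exp_of_real)
    finally have 2: "exp ((1 - u) * complex_of_real (ln t)) = complex_of_real t * exp (- u * complex_of_real (ln t))" .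
    show ?thesis
      unfolding H_kernel_eq[OF that] gamma_ratio_def mellin_F_cut 1 2 by (simp only: mult_ac)
  qed
  have pt': "(1 - Complex 1 \<tau>) ^ 0 * H_kernel (Complex 1 \<tau>) * exp ((1 - Complex 1 \<tau>) * complex_of_real (ln t)) =
     complex_of_real t * (Gamma ((1 + Complex 1 \<tau>) / 2) / Gamma ((2 - Complex 1 \<tau>) / 2) *
       complex_of_real (pi * t) powr (- Complex 1 \<tau>) * mellin (\<lambda>x. complex_of_real (F_cut x)) (Complex 1 \<tau>))" for \<tau>
    unfolding power_0 mult_1 by (rule pt) simp
  have "complex_of_real t * H_cut t = complex_of_real (sqrt pi / (2 * pi)) *
     (complex_of_real t * (\<integral>\<tau>. Gamma ((1 + Complex 1 \<tau>) / 2) / Gamma ((2 - Complex 1 \<tau>) / 2) *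
        complex_of_real (pi * t) powr (- Complex 1 \<tau>) * mellin (\<lambda>x. complex_of_real (F_cut x)) (Complex 1 \<tau>) \<partial>lborel))"
    unfolding H_cut_def vline_integral_def integral_mult_left_zero by (simp add: field_simps)
  also have "\<dots> = H_seq 0 t"
    unfolding H_seq_def pt' integral_mult_right_zero ..
  finally show ?thesis by simp
qed

text \<open>On Re u = 1 one has 1 - u = -i \<tau>, so the integral is a Fourier integral in ln t,
  and each moment it needs is again of the form (1 - u)^i times the kernel.\<close>

lemma H_seq_deriv:
  assumes t: "t > 0"
  shows "(H_seq j has_vector_derivative H_seq (Suc j) t / complex_of_real t) (at t)"
proof -
  define f where "f = (\<lambda>\<tau>. (1 - Complex 1 \<tau>) ^ j * H_kernel (Complex 1 \<tau>))"
  define c where "c = complex_of_real (sqrt pi / (2 * pi))"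
  have 1: "1 - Complex 1 \<tau> = - \<i> * complex_of_real \<tau>" for \<tau>
    by (simp add: complex_eq_iff)
  have int: "integrable lborel (\<lambda>\<tau>. (1 - Complex 1 \<tau>) ^ i * H_kernel (Complex 1 \<tau>))" for i
  proof -
    obtain C where C: "\<And>u. 1 \<le> Re u \<Longrightarrow> Re u \<le> real 1 \<Longrightarrow> norm ((1 - u) ^ i * H_kernel u) * (1 + (Im u)\<^sup>2) \<le> C"
      using H_kernel_strip_bound[of 1 i] by blast
    \<comment> \<open>A degenerate shift from the line Re u = 1 to itself, used for its
      integrability conclusion.\<close>
    show ?thesis
      by (rule vertical_line_integral_shift(2)[where g = "\<lambda>u. (1 - u) ^ i * H_kernel u" and b = 1 and C = C])
         (auto intro!: holomorphic_intros H_kernel_holomorphic C)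
  qed
  have i0: "integrable lborel f" using int[of j] by (simp add: f_def)
  have i1: "integrable lborel (\<lambda>\<tau>. (- \<i> * complex_of_real \<tau>) * f \<tau>)"
    using int[of "Suc j"] unfolding f_def 1 by (simp only: power_Suc mult.assoc)
  have i2: "integrable lborel (\<lambda>\<tau>. (- \<i> * complex_of_real \<tau>)\<^sup>2 * f \<tau>)"
    using int[of "2 + j"] unfolding f_def 1 by (simp only: power_add mult.assoc)
  define h where "h = (\<lambda>v::real. \<integral>\<tau>. f \<tau> * exp (- \<i> * of_real \<tau> * of_real v) \<partial>lborel)"
  define h' where "h' = (\<lambda>v::real. \<integral>\<tau>. (- \<i> * of_real \<tau>) * f \<tau> * exp (- \<i> * of_real \<tau> * of_real v) \<partial>lborel)"
  have "(h has_vector_derivative h' (ln t)) (at (ln t))"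
    unfolding h_def h'_def by (rule fourier_transform_has_vector_derivative[OF i0 i1 i2])
  moreover have "(ln has_vector_derivative 1 / t) (at t)"
    using DERIV_ln_divide[OF t] by (simp add: has_real_derivative_iff_has_vector_derivative)
  ultimately have "((h \<circ> ln) has_vector_derivative (1 / t) *\<^sub>R h' (ln t)) (at t)"
    by (intro vector_diff_chain_at)
  then have "((\<lambda>t. c * h (ln t)) has_vector_derivative c * ((1 / t) *\<^sub>R h' (ln t))) (at t)"
    unfolding o_def by (rule has_vector_derivative_mult_right)
  moreover have "H_seq j = (\<lambda>t. c * h (ln t))"
    unfolding H_seq_def[abs_def] h_def f_def c_def 1 ..
  moreover have "c * ((1 / t) *\<^sub>R h' (ln t)) = H_seq (Suc j) t / complex_of_real t"
    unfolding H_seq_def h'_def f_def c_def 1 by (simp add: scaleR_conv_of_real mult_ac)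
  ultimately show ?thesis by simp
qed

text \<open>On the line Re u = B + 1 the modulus of t^(1-u) is exactly t^(-B).\<close>

lemma H_seq_bounded: "\<exists>C. \<forall>t>0. norm (H_seq j t) * t ^ B \<le> C"
proof -
  obtain C where C: "\<And>u. 1 \<le> Re u \<Longrightarrow> Re u \<le> real (Suc B) \<Longrightarrow> norm ((1 - u) ^ j * H_kernel u) * (1 + (Im u)\<^sup>2) \<le> C"
    using H_kernel_strip_bound[of "Suc B" j] by blast
  define J where "J = (\<integral>\<tau>. C * inverse (1 + \<tau>\<^sup>2) \<partial>(lborel :: real measure))"
  have "norm (H_seq j t) * t ^ B \<le> \<bar>sqrt pi / (2 * pi)\<bar> * J" if t: "t > 0" for t
  proof -
    define g where "g = (\<lambda>u. (1 - u) ^ j * H_kernel u * exp ((1 - u) * complex_of_real (ln t)))"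
    have hol: "g holomorphic_on {u. Re u > 0}"
      unfolding g_def by (intro holomorphic_intros H_kernel_holomorphic)
    have ng: "norm (g u) * (1 + (Im u)\<^sup>2) = (norm ((1 - u) ^ j * H_kernel u) * (1 + (Im u)\<^sup>2)) * exp ((1 - Re u) * ln t)" for u
      by (simp add: g_def norm_mult norm_exp_eq_Re)
    \<comment> \<open>This constant depends on t, which is harmless: it only licenses the shift of
      the line. The final estimate uses \<open>C\<close>, which is independent of t.\<close>
    define D where "D = C * exp (real B * \<bar>ln t\<bar>)"
    have bd: "norm (g u) * (1 + (Im u)\<^sup>2) \<le> D" if "1 \<le> Re u" "Re u \<le> real (Suc B)" for u
    proof -
      have "(1 - Re u) * ln t \<le> \<bar>1 - Re u\<bar> * \<bar>ln t\<bar>" by (metis abs_ge_self abs_mult)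
      also have "\<dots> \<le> real B * \<bar>ln t\<bar>" using that by (intro mult_right_mono) auto
      finally show ?thesis
        unfolding ng D_def using C[OF that]
        by (intro mult_mono order_trans[OF _ C[OF that]]) (auto intro!: mult_nonneg_nonneg)
    qed
    have "(\<integral>\<tau>. g (Complex 1 \<tau>) \<partial>lborel) = (\<integral>\<tau>. g (Complex (real (Suc B)) \<tau>) \<partial>lborel)"
      by (rule vertical_line_integral_shift(1)[OF _ _ hol bd]) auto
    then have eq: "H_seq j t = complex_of_real (sqrt pi / (2 * pi)) * (\<integral>\<tau>. g (Complex (real (Suc B)) \<tau>) \<partial>lborel)"
      by (simp add: H_seq_def g_def)
    have tB: "exp (- real B * ln t) * t ^ B = 1"
    proof -
      have "t ^ B = exp (real B * ln t)" using t by (simp add: exp_of_nat_mult)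
      then show ?thesis by (simp flip: exp_add)
    qed
    have "norm (\<integral>\<tau>. g (Complex (real (Suc B)) \<tau>) \<partial>lborel) \<le> (\<integral>\<tau>. exp (- real B * ln t) * (C * inverse (1 + \<tau>\<^sup>2)) \<partial>lborel)"
    proof (rule Bochner_Integration.integral_norm_bound_integral)
      show "integrable lborel (\<lambda>\<tau>. g (Complex (real (Suc B)) \<tau>))"
        by (rule vertical_line_integral_shift(2)[OF _ order_refl hol bd]) auto
      show "integrable lborel (\<lambda>\<tau>::real. exp (- real B * ln t) * (C * inverse (1 + \<tau>\<^sup>2)))"
        using integrable_inverse_1_plus_square by (simp add: set_integrable_def)
      fix \<tau> :: real
      define z where "z = Complex (real (Suc B)) \<tau>"
      have "norm (g z) * (1 + (Im z)\<^sup>2) \<le> C * exp ((1 - Re z) * ln t)"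
        unfolding ng by (intro mult_right_mono C) (auto simp: z_def)
      then have "norm (g (Complex (real (Suc B)) \<tau>)) * (1 + \<tau>\<^sup>2) \<le> C * exp (- real B * ln t)"
        by (simp add: z_def)
      then show "norm (g (Complex (real (Suc B)) \<tau>)) \<le> exp (- real B * ln t) * (C * inverse (1 + \<tau>\<^sup>2))"
        by (simp add: field_simps add_pos_nonneg)
    qed
    also have "\<dots> = exp (- real B * ln t) * J" by (simp add: J_def)
    finally have "norm (H_seq j t) \<le> \<bar>sqrt pi / (2 * pi)\<bar> * (exp (- real B * ln t) * J)"
      unfolding eq norm_mult norm_of_real by (intro mult_left_mono) auto
    then have "norm (H_seq j t) * t ^ B \<le> \<bar>sqrt pi / (2 * pi)\<bar> * (exp (- real B * ln t) * J) * t ^ B"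
      using t by (intro mult_right_mono) auto
    also have "\<dots> = \<bar>sqrt pi / (2 * pi)\<bar> * J * (exp (- real B * ln t) * t ^ B)"
      by (simp only: mult_ac)
    finally show ?thesis unfolding tB by simp
  qed
  then show ?thesis by blast
qed

section \<open>The combined weight F(t) + t H(t)\<close>

definition weight_seq :: "nat \<Rightarrow> real \<Rightarrow> complex" where
  "weight_seq j t = complex_of_real (F_seq j t) + H_seq j t"

interpretation weight: euler_decay weight_seq
proof
  fix t :: real and j B :: nat
  show "(weight_seq j has_vector_derivative weight_seq (Suc j) t / complex_of_real t) (at t)" if "t > 0"
    using has_vector_derivative_add[OF has_vector_derivative_of_real[OF F_seq_deriv[OF that, of j]] H_seq_deriv[OF that, of j]]
    unfolding weight_seq_def[abs_def] by (simp add: add_divide_distrib)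
  obtain C1 where C1: "\<And>t. t > 0 \<Longrightarrow> \<bar>F_seq j t\<bar> * t ^ B \<le> C1" using F_seq_bounded by blast
  obtain C2 where C2: "\<And>t. t > 0 \<Longrightarrow> norm (H_seq j t) * t ^ B \<le> C2" using H_seq_bounded by blast
  have "norm (weight_seq j t) * t ^ B \<le> C1 + C2" if "t > 0" for t
  proof -
    have "norm (weight_seq j t) \<le> \<bar>F_seq j t\<bar> + norm (H_seq j t)"
      unfolding weight_seq_def by (metis norm_of_real norm_triangle_ineq)
    then have "norm (weight_seq j t) * t ^ B \<le> (\<bar>F_seq j t\<bar> + norm (H_seq j t)) * t ^ B"
      using that by (intro mult_right_mono) auto
    with C1[OF that] C2[OF that] show ?thesis by (simp add: distrib_right)
  qed
  then show "\<exists>C. \<forall>t>0. norm (weight_seq j t) * t ^ B \<le> C" by blast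
qed

section \<open>Summation\<close>

text \<open>The binomial theorem in x and r = (1 - x^2)^(1/2) writes the archimedean function as a
  combination of the prefactors of \<open>atom\<close>, with nonnegative half-integral
  exponents.\<close>

lemma theta_inf_expansion:
  "\<exists>c :: nat \<Rightarrow> complex. \<forall>x. \<bar>x\<bar> < 1 \<longrightarrow>
     theta_inf k x = (\<Sum>i\<le>k - 1. c i * complex_of_real (x ^ i * (1 - x\<^sup>2) powr (real (k - 1 - i) / 2)))"
proof -
  define m where "m = k - 1"
  define c where "c = (\<lambda>i. \<i> / (2 * complex_of_real pi) * of_nat (m choose i) * (\<i> ^ (m - i) - (- \<i>) ^ (m - i)))"
  have "theta_inf k x = (\<Sum>i\<le>m. c i * complex_of_real (x ^ i * (1 - x\<^sup>2) powr (real (m - i) / 2)))" if x: "\<bar>x\<bar> < 1" for x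
  proof -
    define r where "r = sqrt (1 - x\<^sup>2)"
    have s: "1 - x\<^sup>2 > 0" using x by (simp add: abs_square_less_1)
    have rp: "(1 - x\<^sup>2) powr (real i / 2) = r ^ i" for i
      using s by (simp add: r_def powr_half_sqrt[symmetric] powr_powr flip: powr_realpow)
    have "(complex_of_real x + \<i> * complex_of_real r) ^ m - (complex_of_real x - \<i> * complex_of_real r) ^ m =
      (complex_of_real x + \<i> * complex_of_real r) ^ m - (complex_of_real x + (- \<i>) * complex_of_real r) ^ m"
      by simp
    also have "\<dots> = (\<Sum>i\<le>m. of_nat (m choose i) * (\<i> ^ (m - i) - (- \<i>) ^ (m - i)) * complex_of_real (x ^ i * r ^ (m - i)))"
      unfolding binomial_ring power_mult_distrib
      by (subst sum_subtractf[symmetric]) (simp add: algebra_simps)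
    finally have "theta_inf k x = \<i> / (2 * complex_of_real pi) *
        (\<Sum>i\<le>m. of_nat (m choose i) * (\<i> ^ (m - i) - (- \<i>) ^ (m - i)) * complex_of_real (x ^ i * r ^ (m - i)))"
      using x unfolding theta_inf_def r_def[symmetric] m_def[symmetric] by simp
    then show ?thesis
      unfolding rp c_def by (simp only: sum_distrib_left mult.assoc)
  qed
  then show ?thesis unfolding m_def by blast
qed

text \<open>The coefficients come from \<open>theta_inf\<close> alone and are fixed before l, f, n
  and \<xi>; those parameters enter only through T and \<eta>, in which the oscillatory bounds are
  uniform.\<close>

lemma I_int_expansion:
  "\<exists>c :: nat \<Rightarrow> complex. \<forall>l\<ge>1. \<forall>f\<ge>1. \<forall>n\<ge>1. \<forall>\<xi>. I_int k l f \<xi> n =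
     (\<Sum>i\<le>k - 1. c i * weight.osc_integral i (real (k - 1 - i) / 2) 0
        (real l * real f ^ 2 * (4 * real n) powr (- 1 / 2))
        (real_of_int \<xi> * sqrt (real n) / (2 * real l * real f ^ 2)))"
proof -
  obtain c where c: "\<And>x. \<bar>x\<bar> < 1 \<Longrightarrow>
     theta_inf k x = (\<Sum>i\<le>k - 1. c i * complex_of_real (x ^ i * (1 - x\<^sup>2) powr (real (k - 1 - i) / 2)))"
    using theta_inf_expansion by blast
  have "I_int k l f \<xi> n = (\<Sum>i\<le>k - 1. c i * weight.osc_integral i (real (k - 1 - i) / 2) 0 T \<eta>)"
    if "l \<ge> 1" "f \<ge> 1" "n \<ge> 1" and T: "T = real l * real f ^ 2 * (4 * real n) powr (- 1 / 2)"
      and \<eta>: "\<eta> = real_of_int \<xi> * sqrt (real n) / (2 * real l * real f ^ 2)" for l f n \<xi> T \<eta>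
  proof -
    have T0: "T > 0" using that by simp
    have ei: "einterval (-1) 1 = {-1<..<1::real}"
      by (auto simp: einterval_def one_ereal_def)
    have "I_int k l f \<xi> n = (LBINT x:{-1<..<1}.
        theta_inf k x * (complex_of_real (F_cut (T / sqrt (1 - x\<^sup>2))) + complex_of_real (T / sqrt (1 - x\<^sup>2)) * H_cut (T / sqrt (1 - x\<^sup>2))) *
            e_add (- x * real_of_int \<xi> * sqrt (real n) / (2 * real l * real f ^ 2)))"
      unfolding I_int_def interval_lebesgue_integral_def ei Let_def T by (simp add: one_ereal_def)
    also have "\<dots> = (LBINT x:{-1<..<1}. \<Sum>i\<le>k - 1. c i * (weight.atom i (real (k - 1 - i) / 2) 0 T x * e_add (- (\<eta> * x))))"
    proof (rule set_lebesgue_integral_cong)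
      show "\<forall>x. x \<in> {-1<..<1} \<longrightarrow>
        theta_inf k x * (complex_of_real (F_cut (T / sqrt (1 - x\<^sup>2))) + complex_of_real (T / sqrt (1 - x\<^sup>2)) * H_cut (T / sqrt (1 - x\<^sup>2))) *
            e_add (- x * real_of_int \<xi> * sqrt (real n) / (2 * real l * real f ^ 2)) =
        (\<Sum>i\<le>k - 1. c i * (weight.atom i (real (k - 1 - i) / 2) 0 T x * e_add (- (\<eta> * x))))"
      proof (intro allI impI)
        fix x :: real assume "x \<in> {-1<..<1}"
        then have x: "\<bar>x\<bar> < 1" by auto
        have s: "1 - x\<^sup>2 > 0" using x by (simp add: abs_square_less_1)
        have t: "T / sqrt (1 - x\<^sup>2) > 0" using s T0 by simp
        have 1: "complex_of_real (F_cut (T / sqrt (1 - x\<^sup>2))) + complex_of_real (T / sqrt (1 - x\<^sup>2)) * H_cut (T / sqrt (1 - x\<^sup>2)) = weight_seq 0 (T / sqrt (1 - x\<^sup>2))"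
          by (simp only: weight_seq_def F_seq_0 H_seq_0[OF t])
        have 2: "- x * real_of_int \<xi> * sqrt (real n) / (2 * real l * real f ^ 2) = - (\<eta> * x)"
          by (simp add: \<eta>)
        show "theta_inf k x * (complex_of_real (F_cut (T / sqrt (1 - x\<^sup>2))) + complex_of_real (T / sqrt (1 - x\<^sup>2)) * H_cut (T / sqrt (1 - x\<^sup>2))) *
            e_add (- x * real_of_int \<xi> * sqrt (real n) / (2 * real l * real f ^ 2)) =
          (\<Sum>i\<le>k - 1. c i * (weight.atom i (real (k - 1 - i) / 2) 0 T x * e_add (- (\<eta> * x))))"
          unfolding 1 2 c[OF x] weight.atom_def by (simp only: sum_distrib_right mult.assoc)
      qed
    qed simp
    also have "\<dots> = (\<Sum>i\<le>k - 1. c i * weight.osc_integral i (real (k - 1 - i) / 2) 0 T \<eta>)"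
    proof -
      have "integrable lborel (\<lambda>x. c i * (indicat_real {-1<..<1} x *\<^sub>R (weight.atom i (real (k - 1 - i) / 2) 0 T x * e_add (- (\<eta> * x)))))" for i
        using weight.set_integrable_atom[OF T0] by (intro integrable_mult_right) (simp add: set_integrable_def)
      then show ?thesis
        unfolding set_lebesgue_integral_def weight.osc_integral_def scaleR_sum_right mult_scaleR_right[symmetric]
        by (subst Bochner_Integration.integral_sum) (simp_all only: integral_mult_right_zero)
    qed
    finally show ?thesis .
  qed
  then show ?thesis by blast
qed

lemma norm_I_int_le:
  "\<exists>C\<ge>0. \<forall>l\<ge>1. \<forall>f\<ge>1. \<forall>n\<ge>1. \<forall>\<xi>\<ge>1.
     norm (I_int k l f \<xi> n) \<le> C * (sqrt (real n) / (real l * real f ^ 2 * real_of_int \<xi>)) ^ M"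
proof -
  obtain c where c: "\<And>l f n \<xi>. l \<ge> 1 \<Longrightarrow> f \<ge> 1 \<Longrightarrow> n \<ge> 1 \<Longrightarrow> I_int k l f \<xi> n =
     (\<Sum>i\<le>k - 1. c i * weight.osc_integral i (real (k - 1 - i) / 2) 0
        (real l * real f ^ 2 * (4 * real n) powr (- 1 / 2))
        (real_of_int \<xi> * sqrt (real n) / (2 * real l * real f ^ 2)))"
    using I_int_expansion[of k] by blast
  have "\<exists>C\<ge>0. \<forall>T>0. \<forall>\<eta>>0. norm (weight.osc_integral i (real (k - 1 - i) / 2) 0 T \<eta>) \<le> C / (\<eta> ^ M * T ^ (2 * M))" for i
    by (rule weight.norm_osc_integral_le) simp
  then obtain C where C: "\<And>i. C i \<ge> 0" "\<And>i T \<eta>. T > 0 \<Longrightarrow> \<eta> > 0 \<Longrightarrow>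
      norm (weight.osc_integral i (real (k - 1 - i) / 2) 0 T \<eta>) \<le> C i / (\<eta> ^ M * T ^ (2 * M))"
    by metis
  \<comment> \<open>The 8 comes from \<eta> T^2 = \<xi> L / (8 \<surd>n) with L = l f^2.\<close>
  define D where "D = (\<Sum>i\<le>k - 1. norm (c i) * C i) * 8 ^ M"
  have "norm (I_int k l f \<xi> n) \<le> D * (sqrt (real n) / (real l * real f ^ 2 * real_of_int \<xi>)) ^ M"
    if "l \<ge> 1" "f \<ge> 1" "n \<ge> 1" "\<xi> \<ge> 1" for l f n \<xi>
  proof -
    define T where "T = real l * real f ^ 2 * (4 * real n) powr (- 1 / 2)"
    define \<eta> where "\<eta> = real_of_int \<xi> * sqrt (real n) / (2 * real l * real f ^ 2)"
    define L where "L = real l * real f ^ 2"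
    have pos: "T > 0" "\<eta> > 0" "L > 0" using that by (simp_all add: T_def \<eta>_def L_def)
    have "((4 * real n) powr (- 1 / 2))\<^sup>2 = (4 * real n) powr (- 1 / 2 + - 1 / 2)"
      unfolding powr_add by (rule power2_eq_square)
    also have "\<dots> = 1 / (4 * real n)"
      using that by (simp add: powr_minus_divide)
    finally have 1: "T\<^sup>2 = L\<^sup>2 / (4 * real n)"
      by (simp add: T_def L_def power_mult_distrib)
    define r where "r = sqrt (real n)"
    have r: "r > 0" "real n = r * r" using that by (simp_all add: r_def)
    have 2: "\<eta> = real_of_int \<xi> * r / (2 * L)"
      by (simp add: \<eta>_def L_def r_def mult.assoc)
    have "\<eta> * T\<^sup>2 = real_of_int \<xi> * L / (8 * r)"
      unfolding 1 2 r(2) using r(1) pos(3) by (simp add: field_simps power2_eq_square)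
    then have "\<eta> * T\<^sup>2 = real_of_int \<xi> * L / (8 * sqrt (real n))"
      by (simp only: r_def)
    moreover have "\<eta> ^ M * T ^ (2 * M) = (\<eta> * T\<^sup>2) ^ M"
      by (simp add: power_mult_distrib power_mult)
    ultimately have eT: "1 / (\<eta> ^ M * T ^ (2 * M)) = 8 ^ M * (sqrt (real n) / (L * real_of_int \<xi>)) ^ M"
      by (simp add: power_divide power_mult_distrib mult_ac)
    have "norm (I_int k l f \<xi> n) \<le> (\<Sum>i\<le>k - 1. norm (c i) * (C i / (\<eta> ^ M * T ^ (2 * M))))"
      unfolding c[OF that(1-3)] T_def[symmetric] \<eta>_def[symmetric]
      by (intro order_trans[OF norm_sum] sum_mono order_trans[OF eq_refl[OF norm_mult]]
          mult_left_mono C(2) pos norm_ge_zero)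
    also have "\<dots> = (\<Sum>i\<le>k - 1. norm (c i) * C i) * (1 / (\<eta> ^ M * T ^ (2 * M)))"
      by (simp add: sum_divide_distrib)
    finally show ?thesis
      unfolding eT D_def L_def by (simp only: mult_ac)
  qed
  moreover have "D \<ge> 0" unfolding D_def using C(1) by (intro mult_nonneg_nonneg sum_nonneg) auto
  ultimately show ?thesis by blast
qed

section \<open>The exponential sum and a convergent majorant\<close>

lemma abs_kronecker_le: "\<bar>kronecker a m\<bar> \<le> 1"
proof -
  have "\<bar>kronecker_prime a p\<bar> \<le> 1" for p
    by (auto simp: kronecker_prime_def Legendre_def)
  then have "\<bar>\<Prod>p\<in>#P. kronecker_prime a p\<bar> \<le> 1" for P
  proof (induction P)
    case (add p P)
    then show ?case by (auto simp: abs_mult intro!: mult_le_one)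
  qed simp
  then show ?thesis by (auto simp: kronecker_def abs_mult)
qed

lemma norm_Kl_sum_le: "norm (Kl_sum l f \<xi> n) \<le> 4 * real l * real f ^ 2"
proof -
  define A where "A = {a \<in> {0..<4 * int l * int f ^ 2}.
            [a ^ 2 = 4 * int n] (mod int f ^ 2) \<and>
            ([(a ^ 2 - 4 * int n) div int f ^ 2 = 0] (mod 4) \<or>
             [(a ^ 2 - 4 * int n) div int f ^ 2 = 1] (mod 4))}"
  have k: "\<bar>real_of_int (kronecker a m)\<bar> \<le> 1" for a m
    using abs_kronecker_le[of a m] by linarith
  have "norm (Kl_sum l f \<xi> n) \<le> (\<Sum>a\<in>A. 1)"
    unfolding Kl_sum_def A_def[symmetric]
    by (intro order_trans[OF norm_sum] sum_mono) (auto simp: norm_mult k)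
  also have "\<dots> = real (card A)" by simp
  also have "card A \<le> card {0..<4 * int l * int f ^ 2}"
    by (rule card_mono) (auto simp: A_def)
  also have "real (card {0..<4 * int l * int f ^ 2}) = 4 * real l * real f ^ 2"
    by (simp add: nat_mult_distrib nat_power_eq)
  finally show ?thesis by simp
qed

text \<open>A product of three convergent series. Since 1/0 = 0, the indices l = 0 and f = 0
  contribute nothing and the first two ranges can be all of the naturals.\<close>

definition index_weight :: "nat \<times> nat \<times> int \<Rightarrow> real" where
  "index_weight = (\<lambda>(l, f, \<xi>). 1 / (real l)\<^sup>2 * (1 / (real f)\<^sup>2 * (1 / (real_of_int \<xi>)\<^sup>2)))"

lemma index_weight_summable: "index_weight summable_on UNIV \<times> UNIV \<times> {1..}"
proof -
  have "summable (\<lambda>n. norm (1 / (real n)\<^sup>2))"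
    using inverse_power_summable[of 2, where 'a = real] by (simp add: inverse_eq_divide)
  then have a: "(\<lambda>n. 1 / (real n)\<^sup>2) summable_on UNIV"
    by (rule norm_summable_imp_summable_on)
  then have "(\<lambda>n. 1 / (real n)\<^sup>2) summable_on {1..}"
    by (rule summable_on_subset_banach) simp
  moreover have "bij_betw nat {1..} {1..}"
    by (rule bij_betw_byWitness[where f' = int]) auto
  ultimately have "(\<lambda>\<xi>. 1 / (real (nat \<xi>))\<^sup>2) summable_on {1..}"
    using summable_on_reindex_bij_betw[of nat "{1..}" "{1..}" "\<lambda>n. 1 / (real n)\<^sup>2"] by simp
  then have b: "(\<lambda>\<xi>. 1 / (real_of_int \<xi>)\<^sup>2) summable_on {1..}"
    by (rule summable_on_cong[THEN iffD1, rotated]) auto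
  define s where "s = (\<Sum>\<^sub>\<infinity>\<xi>\<in>{1..}. 1 / (real_of_int \<xi>)\<^sup>2)"
  define g where "g = (\<lambda>(f, \<xi>). 1 / (real f)\<^sup>2 * (1 / (real_of_int \<xi>)\<^sup>2))"
  have g: "g summable_on UNIV \<times> {1..}"
  proof (rule summable_on_SigmaI)
    show "((\<lambda>\<xi>. g (f, \<xi>)) has_sum 1 / (real f)\<^sup>2 * s) {1..}" for f
      unfolding g_def s_def prod.case by (intro has_sum_cmult_right has_sum_infsum b)
    show "(\<lambda>f. 1 / (real f)\<^sup>2 * s) summable_on UNIV"
      by (intro summable_on_cmult_left a)
  qed (auto simp: g_def)
  show ?thesis
  proof (rule summable_on_SigmaI)
    show "((\<lambda>y. index_weight (l, y)) has_sum 1 / (real l)\<^sup>2 * infsum g (UNIV \<times> {1..})) (UNIV \<times> {1..})" for l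
    proof -
      have "((\<lambda>y. 1 / (real l)\<^sup>2 * g y) has_sum 1 / (real l)\<^sup>2 * infsum g (UNIV \<times> {1..})) (UNIV \<times> {1..})"
        by (intro has_sum_cmult_right has_sum_infsum g)
      then show ?thesis by (simp add: index_weight_def g_def case_prod_unfold)
    qed
    show "(\<lambda>l. 1 / (real l)\<^sup>2 * infsum g (UNIV \<times> {1..})) summable_on UNIV"
      by (intro summable_on_cmult_left a)
  qed (auto simp: index_weight_def)
qed

lemma norm_S0_term_le:
  assumes "c > 0"
  shows "\<exists>C\<ge>0. \<forall>n\<ge>1. \<forall>p\<in>S0_index c n \<kappa>. norm (S0_term k n p) \<le> C * real n powr (1 - \<kappa> * real P) * index_weight p"
proof -
  obtain C where C: "C \<ge> 0" "\<And>l f n \<xi>. l \<ge> 1 \<Longrightarrow> f \<ge> 1 \<Longrightarrow> n \<ge> 1 \<Longrightarrow> \<xi> \<ge> 1 \<Longrightarrow>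
     norm (I_int k l f \<xi> n) \<le> C * (sqrt (real n) / (real l * real f ^ 2 * real_of_int \<xi>)) ^ (P + 2)"
    using norm_I_int_le[of k "P + 2"] by blast
  define D where "D = 4 * C / c ^ P"
  have "norm (S0_term k n (l, f, \<xi>)) \<le> D * real n powr (1 - \<kappa> * real P) * index_weight (l, f, \<xi>)"
    if n: "n \<ge> 1" and p: "(l, f, \<xi>) \<in> S0_index c n \<kappa>" for n l f \<xi>
  proof -
    define L where "L = real l * real f ^ 2"
    define q where "q = sqrt (real n) / (L * real_of_int \<xi>)"
    have lf: "l \<ge> 1" "f \<ge> 1" and ge: "L * real_of_int \<xi> \<ge> c * real n powr (1 / 2 + \<kappa>)"
      using p by (auto simp: S0_index_def L_def)
    have l1: "real l \<ge> 1" and f1: "real f \<ge> 1" using lf by auto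
    have L1: "L \<ge> 1" unfolding L_def using l1 f1 by (metis mult_mono mult_1 one_le_power zero_le_one of_nat_0_le_iff)
    \<comment> \<open>The threshold in the index set is positive, which forces \<xi> to be
      positive.\<close>
    have "c * real n powr (1 / 2 + \<kappa>) > 0" using assms n by simp
    then have "L * real_of_int \<xi> > 0" using ge by linarith
    then have \<xi>1: "\<xi> \<ge> 1" using L1 by (simp add: zero_less_mult_iff)
    have q0: "q \<ge> 0" using L1 \<xi>1 by (simp add: q_def)
    have "q \<le> sqrt (real n) / (c * real n powr (1 / 2 + \<kappa>))"
      unfolding q_def using ge \<open>c * _ > 0\<close> by (intro divide_left_mono) auto
    also have "\<dots> = real n powr (- \<kappa>) / c"
    proof -
      have "real n powr (1 / 2 + \<kappa>) = sqrt (real n) * real n powr \<kappa>"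
        unfolding powr_add by (simp add: powr_half_sqrt)
      then show ?thesis using n by (simp only:) (simp add: powr_minus field_simps)
    qed
    finally have "q ^ P \<le> (real n powr (- \<kappa>) / c) ^ P"
      using q0 by (rule power_mono)
    also have "\<dots> = real n powr (- \<kappa> * real P) / c ^ P"
      using n by (simp add: power_divide powr_power mult.commute)
    finally have qP: "q ^ P \<le> real n powr (- \<kappa> * real P) / c ^ P" .
    have q2: "q\<^sup>2 \<le> real n * index_weight (l, f, \<xi>)"
    proof -
      \<comment> \<open>L^2 contains f^4; weakening it to f^2 still leaves a convergent
        series.\<close>
      have "real f ^ 2 \<le> (real f ^ 2)\<^sup>2"
        using f1 by (intro self_le_power) auto
      then have A: "(real l)\<^sup>2 * (real f)\<^sup>2 * (real_of_int \<xi>)\<^sup>2 \<le> (L * real_of_int \<xi>)\<^sup>2"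
        unfolding L_def power_mult_distrib by (intro mult_right_mono mult_left_mono) auto
      have B: "(real l)\<^sup>2 * (real f)\<^sup>2 * (real_of_int \<xi>)\<^sup>2 > 0"
        using lf \<xi>1 by simp
      have "real n / (L * real_of_int \<xi>)\<^sup>2 \<le> real n / ((real l)\<^sup>2 * (real f)\<^sup>2 * (real_of_int \<xi>)\<^sup>2)"
        by (rule frac_le[OF of_nat_0_le_iff order_refl B A])
      then show ?thesis
        by (simp add: q_def power_divide index_weight_def mult.assoc)
    qed
    have I: "norm (I_int k l f \<xi> n) \<le> C * (q ^ P * q\<^sup>2)"
      using C(2)[OF lf n \<xi>1] unfolding q_def L_def power_add .
    \<comment> \<open>Cancelling the bound 4 L for the exponential sum takes only one power of L;
      convergence in l and f is supplied by q^2.\<close>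
    have Lp: "L \<le> L powr (3 / 2)"
      using powr_mono[of 1 "3 / 2" L] L1 by simp
    have "norm (S0_term k n (l, f, \<xi>)) = norm (Kl_sum l f \<xi> n) / sqrt (real l) * (norm (I_int k l f \<xi> n) / L powr (3 / 2))"
      by (simp add: S0_term_def norm_mult norm_divide L_def)
    also have "\<dots> \<le> (4 * L) / 1 * (norm (I_int k l f \<xi> n) / L)"
      using norm_Kl_sum_le[of l f \<xi> n] l1 L1 Lp
      by (intro mult_mono frac_le) (auto simp: L_def mult.assoc)
    also have "\<dots> = 4 * norm (I_int k l f \<xi> n)" using L1 by simp
    also have "\<dots> \<le> 4 * (C * (q ^ P * q\<^sup>2))" using I by simp
    also have "\<dots> \<le> 4 * (C * ((real n powr (- \<kappa> * real P) / c ^ P) * (real n * index_weight (l, f, \<xi>))))"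
      using C(1) q0 assms by (intro mult_left_mono mult_mono qP q2) auto
    also have "\<dots> = D * (real n * real n powr (- \<kappa> * real P)) * index_weight (l, f, \<xi>)"
      by (simp add: D_def)
    also have "real n * real n powr (- \<kappa> * real P) = real n powr (1 - \<kappa> * real P)"
      using n by (simp add: powr_diff powr_minus divide_inverse)
    finally show ?thesis .
  qed
  moreover have "D \<ge> 0" using C(1) assms by (simp add: D_def)
  ultimately show ?thesis by (metis prod_cases3)
qed

text \<open>Summability is asserted alongside the bound because an infinite sum over a non-summable
  family is 0 by convention, which would satisfy the estimate without content. The constant is
  chosen before n.\<close>

theorem theorem4p9:
  fixes k :: nat and c N \<kappa> :: real
  assumes "even k" and "k > 2" and "c > 0" and "N > 0" and "\<kappa> > 0"
  shows "(\<forall>n\<ge>1. S0_term k n summable_on S0_index c n \<kappa>) \<and>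
         (\<exists>C. \<forall>n\<ge>1. norm (S0 k c n \<kappa>) \<le> C * real n powr (1 / 2 - N * \<kappa>))"
proof -
  \<comment> \<open>The least natural number with 1 - \<kappa> P \<le> 1/2 - N \<kappa>; the 1 is
    the exponent of n lost to the two convergence factors.\<close>
  define P where "P = nat \<lceil>(1 / 2 + N * \<kappa>) / \<kappa>\<rceil>"
  have "(1 / 2 + N * \<kappa>) / \<kappa> \<le> real P" unfolding P_def by (rule real_nat_ceiling_ge)
  then have P: "1 / 2 + N * \<kappa> \<le> \<kappa> * real P"
    using assms(5) by (simp add: pos_divide_le_eq mult.commute)
  obtain C where C: "C \<ge> 0" "\<And>n p. n \<ge> 1 \<Longrightarrow> p \<in> S0_index c n \<kappa> \<Longrightarrow>
      norm (S0_term k n p) \<le> C * real n powr (1 - \<kappa> * real P) * index_weight p"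
    using norm_S0_term_le[OF assms(3), of \<kappa> k P] by blast
  define W where "W = infsum index_weight (UNIV \<times> UNIV \<times> {1..})"
  have sub: "S0_index c n \<kappa> \<subseteq> UNIV \<times> UNIV \<times> {1..}" if "n \<ge> 1" for n
  proof clarsimp
    fix l f \<xi> assume "(l, f, \<xi>) \<in> S0_index c n \<kappa>"
    moreover have "c * real n powr (1 / 2 + \<kappa>) > 0" using assms that by simp
    ultimately have "real l * real f ^ 2 * real_of_int \<xi> > 0"
      unfolding S0_index_def by auto
    then have "\<not> real_of_int \<xi> \<le> 0"
      using mult_nonneg_nonpos[of "real l * real f ^ 2" "real_of_int \<xi>"] by auto
    then show "1 \<le> \<xi>" by simp
  qed
  have w0: "index_weight p \<ge> 0" for p by (auto simp: index_weight_def case_prod_unfold)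
  have ws: "index_weight summable_on S0_index c n \<kappa>" if "n \<ge> 1" for n
    using index_weight_summable sub[OF that] by (rule summable_on_subset_banach)
  have ws': "(\<lambda>p. C * real n powr (1 - \<kappa> * real P) * index_weight p) summable_on S0_index c n \<kappa>" if "n \<ge> 1" for n
    by (intro summable_on_cmult_right ws that)
  have abs: "(\<lambda>p. norm (S0_term k n p)) summable_on S0_index c n \<kappa>" if "n \<ge> 1" for n
    using ws'[OF that] C(2)[OF that] by (rule Infinite_Sum.abs_summable_on_comparison_test')
  have "norm (S0 k c n \<kappa>) \<le> (C * W) * real n powr (1 / 2 - N * \<kappa>)" if n: "n \<ge> 1" for n
  proof -
    have "norm (S0 k c n \<kappa>) \<le> (\<Sum>\<^sub>\<infinity>p\<in>S0_index c n \<kappa>. norm (S0_term k n p))"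
      unfolding S0_def by (rule norm_infsum_bound[OF abs[OF n]])
    also have "\<dots> \<le> (\<Sum>\<^sub>\<infinity>p\<in>S0_index c n \<kappa>. C * real n powr (1 - \<kappa> * real P) * index_weight p)"
      by (intro infsum_mono abs ws' n C(2))
    also have "\<dots> = C * real n powr (1 - \<kappa> * real P) * infsum index_weight (S0_index c n \<kappa>)"
      by (rule infsum_cmult_right') 
    also have "\<dots> \<le> C * real n powr (1 / 2 - N * \<kappa>) * W"
    proof (intro mult_mono)
      show "infsum index_weight (S0_index c n \<kappa>) \<le> W"
        unfolding W_def by (intro infsum_mono2 ws n index_weight_summable sub w0)
      show "real n powr (1 - \<kappa> * real P) \<le> real n powr (1 / 2 - N * \<kappa>)"
        using n P by (intro powr_mono) auto
    qed (use C(1) in \<open>auto intro!: infsum_nonneg w0\<close>)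
    finally show ?thesis by (simp add: mult_ac)
  qed
  then show ?thesis
    using abs_summable_summable[OF abs] by blast
qed

end
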